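(* Let $\{X_n : n\in\omega\}$ be a family of metrizable spaces, and let $A$ be a subspace of the nabla product $\nabla_n X_n$. If $A$ is monotonically normal, then $A$ is hereditarily paracompact.
   Context: The box product $\square_n X_n$ is the set $\prod_n X_n$ with base all boxes $\prod_n U_n$, each $U_n$ open in $X_n$. Two elements $x,y$ of $\square_n X_n$ are mod-finite equivalent, $x\sim y$, if $\{n : x(n)\neq y(n)\}$ is finite. The nabla product $\nabla_n X_n$ is the quotient space $\square_n X_n/\sim$. A space $Y$ is monotonically normal if to every point $x$ and open $U\ni x$ there is assigned an open set $G(x,U)$ with $x\in G(x,U)\subseteq U$ such that if $G(x,U)\cap G(y,V)\neq\emptyset$ then $x\in V$ or $y\in U$. A space is hereditarily paracompact if each of its subspaces is paracompact. *)

theory Defs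
  imports "HOL-Analysis.Analysis"
begin

definition box_topology :: "(nat \<Rightarrow> 'a topology) \<Rightarrow> (nat \<Rightarrow> 'a) topology" where
  "box_topology X =
     topology (arbitrary union_of (\<lambda>B. \<exists>U. (\<forall>n. openin (X n) (U n)) \<and> B = (\<Pi> n\<in>UNIV. U n)))"

lemma openin_box_topology:
  "openin (box_topology X) =
     arbitrary union_of (\<lambda>B. \<exists>U. (\<forall>n. openin (X n) (U n)) \<and> B = (\<Pi> n\<in>UNIV. U n))"
proof -
  have "istopology (arbitrary union_of
      (\<lambda>B. \<exists>U. (\<forall>n. openin (X n) (U n)) \<and> B = (\<Pi> n\<in>UNIV. U n)))"
  proof (rule istopology_base, clarify)
    fix U V assume "\<forall>n. openin (X n) (U n)" "\<forall>n. openin (X n) (V n)"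
    then show "\<exists>W. (\<forall>n. openin (X n) (W n)) \<and> Pi UNIV U \<inter> Pi UNIV V = Pi UNIV W"
      by (intro exI[of _ "\<lambda>n. U n \<inter> V n"]) (auto simp: Pi_def)
  qed
  then show ?thesis
    by (simp add: box_topology_def)
qed

lemma openin_box_topology_iff:
  "openin (box_topology X) S \<longleftrightarrow>
     (\<forall>x\<in>S. \<exists>U. (\<forall>n. openin (X n) (U n)) \<and> x \<in> Pi UNIV U \<and> Pi UNIV U \<subseteq> S)"
proof -
  have ex: "(\<exists>B. (\<exists>U. Q U \<and> B = F U) \<and> x \<in> B \<and> B \<subseteq> S) \<longleftrightarrow> (\<exists>U. Q U \<and> x \<in> F U \<and> F U \<subseteq> S)"
    for Q and F :: "(nat \<Rightarrow> 'a set) \<Rightarrow> (nat \<Rightarrow> 'a) set" and x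
    by auto
  show ?thesis
    by (simp only: openin_box_topology arbitrary_union_of_alt ex)
qed

lemma topspace_box_topology:
  "topspace (box_topology X) = (\<Pi> n\<in>UNIV. topspace (X n))"
proof
  show "topspace (box_topology X) \<subseteq> (\<Pi> n\<in>UNIV. topspace (X n))"
  proof
    fix x assume "x \<in> topspace (box_topology X)"
    then obtain U where "\<forall>n. openin (X n) (U n)" "x \<in> Pi UNIV U"
      using openin_box_topology_iff[of X "topspace (box_topology X)"] by blast
    then show "x \<in> (\<Pi> n\<in>UNIV. topspace (X n))"
      using openin_subset by fastforce
  qed
  have "openin (box_topology X) (\<Pi> n\<in>UNIV. topspace (X n))"
    unfolding openin_box_topology_iff by (meson openin_topspace order_refl)
  then show "(\<Pi> n\<in>UNIV. topspace (X n)) \<subseteq> topspace (box_topology X)"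
    by (rule openin_subset)
qed

lemma box_subset_topspace:
  assumes "\<And>n. openin (X n) (U n)"
  shows "Pi UNIV U \<subseteq> topspace (box_topology X)"
  unfolding topspace_box_topology by (intro Pi_mono openin_subset assms)

definition quotient_topology :: "'a topology \<Rightarrow> ('a \<times> 'a) set \<Rightarrow> 'a set topology" where
  "quotient_topology X R =
     topology (\<lambda>U. U \<subseteq> topspace X // R \<and> openin X {x \<in> topspace X. R `` {x} \<in> U})"

lemma openin_quotient_topology:
  "openin (quotient_topology X R) U \<longleftrightarrow>
     U \<subseteq> topspace X // R \<and> openin X {x \<in> topspace X. R `` {x} \<in> U}"
proof -
  have "istopology (\<lambda>U. U \<subseteq> topspace X // R \<and> openin X {x \<in> topspace X. R `` {x} \<in> U})"
    unfolding istopology_def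
  proof (intro conjI allI impI)
    fix S T
    assume "S \<subseteq> topspace X // R \<and> openin X {x \<in> topspace X. R `` {x} \<in> S}"
      and "T \<subseteq> topspace X // R \<and> openin X {x \<in> topspace X. R `` {x} \<in> T}"
    moreover have "{x \<in> topspace X. R `` {x} \<in> S \<inter> T} =
        {x \<in> topspace X. R `` {x} \<in> S} \<inter> {x \<in> topspace X. R `` {x} \<in> T}"
      by blast
    ultimately show "S \<inter> T \<subseteq> topspace X // R"
      and "openin X {x \<in> topspace X. R `` {x} \<in> S \<inter> T}"
      by auto
  next
    fix \<K>
    assume *: "\<forall>K\<in>\<K>. K \<subseteq> topspace X // R \<and> openin X {x \<in> topspace X. R `` {x} \<in> K}"
    then show "\<Union>\<K> \<subseteq> topspace X // R"
      by blast
    have "{x \<in> topspace X. R `` {x} \<in> \<Union>\<K>} = (\<Union>K\<in>\<K>. {x \<in> topspace X. R `` {x} \<in> K})"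
      by blast
    then show "openin X {x \<in> topspace X. R `` {x} \<in> \<Union>\<K>}"
      using * by auto
  qed
  then show ?thesis
    by (simp add: quotient_topology_def)
qed

lemma topspace_quotient_topology: "topspace (quotient_topology X R) = topspace X // R"
proof
  show "topspace (quotient_topology X R) \<subseteq> topspace X // R"
    using openin_quotient_topology[of X R "topspace (quotient_topology X R)"] by simp
  have "{x \<in> topspace X. R `` {x} \<in> topspace X // R} = topspace X"
    by (auto intro: quotientI)
  then have "openin (quotient_topology X R) (topspace X // R)"
    by (simp add: openin_quotient_topology)
  then show "topspace X // R \<subseteq> topspace (quotient_topology X R)"
    by (rule openin_subset)
qed

lemma quotient_map_quotient_topology:
  "quotient_map X (quotient_topology X R) (\<lambda>x. R `` {x})"
  unfolding quotient_map_def topspace_quotient_topology openin_quotient_topology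
  by (auto simp: quotient_def)

definition mod_finite :: "(nat \<Rightarrow> 'a topology) \<Rightarrow> ((nat \<Rightarrow> 'a) \<times> (nat \<Rightarrow> 'a)) set" where
  "mod_finite X =
     {(x, y). x \<in> topspace (box_topology X) \<and> y \<in> topspace (box_topology X)
              \<and> finite {n. x n \<noteq> y n}}"

lemma equiv_mod_finite: "equiv (topspace (box_topology X)) (mod_finite X)"
proof (rule equivI)
  show "mod_finite X \<subseteq> topspace (box_topology X) \<times> topspace (box_topology X)"
    and "refl_on (topspace (box_topology X)) (mod_finite X)"
    by (auto simp: mod_finite_def refl_on_def)
  show "sym (mod_finite X)"
    by (auto simp: mod_finite_def sym_def eq_commute)
  show "trans (mod_finite X)"
  proof (rule transI)
    fix x y z assume "(x, y) \<in> mod_finite X" "(y, z) \<in> mod_finite X"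
    moreover have "{n. x n \<noteq> z n} \<subseteq> {n. x n \<noteq> y n} \<union> {n. y n \<noteq> z n}"
      by auto
    ultimately show "(x, z) \<in> mod_finite X"
      unfolding mod_finite_def by (auto intro: finite_subset)
  qed
qed

definition nabla_topology :: "(nat \<Rightarrow> 'a topology) \<Rightarrow> (nat \<Rightarrow> 'a) set topology" where
  "nabla_topology X = quotient_topology (box_topology X) (mod_finite X)"

definition monotonically_normal_space :: "'a topology \<Rightarrow> bool" where
  "monotonically_normal_space Y \<longleftrightarrow>
     (\<exists>G. (\<forall>x U. openin Y U \<and> x \<in> U \<longrightarrow> openin Y (G x U) \<and> x \<in> G x U \<and> G x U \<subseteq> U) \<and>
          (\<forall>x U y V. openin Y U \<and> x \<in> U \<and> openin Y V \<and> y \<in> V \<and> G x U \<inter> G y V \<noteq> {}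
                     \<longrightarrow> x \<in> V \<or> y \<in> U))"

text \<open>No separation axiom is built into paracompactness. For subspaces of nabla products of
  metrizable spaces this makes no difference, since they are Hausdorff: see
  \<open>Hausdorff_space_nabla_topology\<close> below and \<open>Hausdorff_space_subtopology\<close>.\<close>

definition paracompact_space :: "'a topology \<Rightarrow> bool" where
  "paracompact_space Y \<longleftrightarrow>
     (\<forall>\<U>. (\<forall>U\<in>\<U>. openin Y U) \<and> \<Union>\<U> = topspace Y \<longrightarrow>
        (\<exists>\<V>. (\<forall>V\<in>\<V>. openin Y V) \<and> \<Union>\<V> = topspace Y \<and>
             (\<forall>V\<in>\<V>. \<exists>U\<in>\<U>. V \<subseteq> U) \<and> locally_finite_in Y \<V>))"

definition hereditarily_paracompact_space :: "'a topology \<Rightarrow> bool" where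
  "hereditarily_paracompact_space Y \<longleftrightarrow>
     (\<forall>S. S \<subseteq> topspace Y \<longrightarrow> paracompact_space (subtopology Y S))"

lemma openin_nabla_image_box:
  assumes U: "\<And>n. openin (X n) (U n)"
  shows "openin (nabla_topology X) ((\<lambda>x. mod_finite X `` {x}) ` Pi UNIV U)"
proof -
  let ?B = "topspace (box_topology X)" and ?q = "\<lambda>x. mod_finite X `` {x}"
  have sub: "Pi UNIV U \<subseteq> ?B"
    by (intro box_subset_topspace U)
  have "openin (box_topology X) {x \<in> ?B. ?q x \<in> ?q ` Pi UNIV U}"
    unfolding openin_box_topology_iff
  proof
    fix x assume x: "x \<in> {x \<in> ?B. ?q x \<in> ?q ` Pi UNIV U}"
    then obtain u where u: "u \<in> Pi UNIV U" "?q x = ?q u"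
      by auto
    then have fin: "finite {n. x n \<noteq> u n}"
      using x sub eq_equiv_class_iff[OF equiv_mod_finite, of x X u] by (auto simp: mod_finite_def)
    define W where "W = (\<lambda>n. if x n = u n then U n else topspace (X n))"
    have W: "\<forall>n. openin (X n) (W n)"
      by (simp add: W_def U)
    have xW: "x \<in> Pi UNIV W"
      using x u by (auto simp: W_def Pi_def topspace_box_topology)
    have "Pi UNIV W \<subseteq> {x \<in> ?B. ?q x \<in> ?q ` Pi UNIV U}"
    proof
      fix w assume w: "w \<in> Pi UNIV W"
      then have wB: "w \<in> ?B"
        using W box_subset_topspace by blast
      define v where "v = (\<lambda>n. if x n = u n then w n else u n)"
      have v: "v \<in> Pi UNIV U"
        using w u unfolding v_def W_def Pi_def by (auto split: if_splits)
      have "finite {n. w n \<noteq> v n}"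
        by (rule finite_subset[OF _ fin]) (auto simp: v_def)
      then have "(w, v) \<in> mod_finite X"
        using wB v sub by (auto simp: mod_finite_def)
      then have "?q w = ?q v"
        by (rule equiv_class_eq[OF equiv_mod_finite])
      then show "w \<in> {x \<in> ?B. ?q x \<in> ?q ` Pi UNIV U}"
        using wB v by blast
    qed
    then show "\<exists>W. (\<forall>n. openin (X n) (W n)) \<and> x \<in> Pi UNIV W \<and>
                   Pi UNIV W \<subseteq> {x \<in> ?B. ?q x \<in> ?q ` Pi UNIV U}"
      using W xW by blast
  qed
  then show ?thesis
    using sub by (auto simp: nabla_topology_def openin_quotient_topology intro: quotientI)
qed

lemma Hausdorff_space_nabla_topology:
  assumes H: "\<And>n. Hausdorff_space (X n)"
  shows "Hausdorff_space (nabla_topology X)"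
  unfolding Hausdorff_space_def
proof (intro allI impI, elim conjE)
  let ?B = "topspace (box_topology X)" and ?q = "\<lambda>x. mod_finite X `` {x}"
  fix a b assume "a \<in> topspace (nabla_topology X)" "b \<in> topspace (nabla_topology X)" "a \<noteq> b"
  then obtain x y where x: "x \<in> ?B" "a = ?q x" and y: "y \<in> ?B" "b = ?q y"
    by (auto simp: nabla_topology_def topspace_quotient_topology quotient_def)
  have inf: "infinite {n. x n \<noteq> y n}"
    using \<open>a \<noteq> b\<close> x y eq_equiv_class_iff[OF equiv_mod_finite, of x X y]
    by (auto simp: mod_finite_def)
  have "\<forall>n. \<exists>U V. openin (X n) U \<and> openin (X n) V \<and> x n \<in> U \<and> y n \<in> V \<and>
                  (x n \<noteq> y n \<longrightarrow> disjnt U V)"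
  proof
    fix n
    have "x n \<in> topspace (X n)" "y n \<in> topspace (X n)"
      using x y by (auto simp: topspace_box_topology)
    then show "\<exists>U V. openin (X n) U \<and> openin (X n) V \<and> x n \<in> U \<and> y n \<in> V \<and>
                     (x n \<noteq> y n \<longrightarrow> disjnt U V)"
      using H[of n] unfolding Hausdorff_space_def by (metis openin_topspace)
  qed
  then obtain U V where UV: "\<And>n. openin (X n) (U n)" "\<And>n. openin (X n) (V n)"
      "\<And>n. x n \<in> U n" "\<And>n. y n \<in> V n" "\<And>n. x n \<noteq> y n \<Longrightarrow> disjnt (U n) (V n)"
    by metis
  have "disjnt (?q ` Pi UNIV U) (?q ` Pi UNIV V)"
  proof (rule ccontr)
    assume "\<not> ?thesis"
    then obtain u v where u: "u \<in> Pi UNIV U" and v: "v \<in> Pi UNIV V" and eq: "?q u = ?q v"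
      unfolding disjnt_def by blast
    have "u \<in> ?B" "v \<in> ?B"
      using u v UV(1,2) box_subset_topspace[of X U] box_subset_topspace[of X V] by auto
    then have "finite {n. u n \<noteq> v n}"
      using eq eq_equiv_class_iff[OF equiv_mod_finite, of u X v] by (auto simp: mod_finite_def)
    moreover have "{n. x n \<noteq> y n} \<subseteq> {n. u n \<noteq> v n}"
    proof clarify
      fix n assume "x n \<noteq> y n" "u n = v n"
      moreover have "u n \<in> U n" "v n \<in> V n"
        using u v by auto
      ultimately show False
        using UV(5)[of n] by (auto simp: disjnt_iff)
    qed
    ultimately show False
      using inf finite_subset by blast
  qed
  moreover have "a \<in> ?q ` Pi UNIV U" "b \<in> ?q ` Pi UNIV V"
    using x y UV by auto
  ultimately show "\<exists>U V. openin (nabla_topology X) U \<and> openin (nabla_topology X) V \<and>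
                         a \<in> U \<and> b \<in> V \<and> disjnt U V"
    using openin_nabla_image_box[of X U] openin_nabla_image_box[of X V] UV(1,2) by blast
qed

end

theory Submission
  imports Defs "HOL-Library.Countable_Set_Type"
begin

text \<open>Monotone normality and the nabla metric are both hereditary, so it suffices that a monotonically
  normal subspace \<open>Y\<close> of a nabla product is paracompact; in fact every open cover has a disjoint open
  refinement. Countable intersections of open sets of \<open>Y\<close> are open, and this lets one iterate the
  monotone normality operator to a clopen neighbourhood assignment \<open>H\<close> refining the cover such that
  the closure of \<open>\<Union>y\<in>X. H y\<close> adds to it only points of the closure of \<open>X\<close>. Fodor's lemma shows that
  long sequences along which this union stationarily often fails to be closed contain a subsequence
  behaving like a stationary subset of a regular cardinal, and the distances of the factors rule that
  out. Hence sets \<open>X\<close> with closed union are abundant, and by induction on the cardinality of \<open>X\<close> (the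
  regular and the singular case separately) every \<open>\<Union>y\<in>X. H y\<close> has a disjoint open refinement.\<close>

section \<open>Stationary sets on linear orders\<close>

text \<open>The model is the Balogh-Rudin theorem: a monotonically normal space that is not
  paracompact has a closed subspace homeomorphic to a stationary subset of a regular uncountable
  cardinal. Such a copy need not be built here; a sequence on which neighbourhoods press down is
  already absurd. For suppose that it converges to \<open>w\<close>. Give \<open>x j\<close> a
  radius that is a small fraction of its distance from \<open>w\<close>, coordinate by coordinate.
  Pressing down fixes an early \<open>x b\<close> within that radius of many later
  \<open>x j\<close>, so \<open>x b\<close> and \<open>x j\<close> are about equally far from
  \<open>w\<close>. But late terms are much closer to \<open>w\<close> than \<open>x b\<close> is.
  Hence late \<open>x j\<close> equal \<open>w\<close>, and two of them coincide. The obstacle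
  behind the induction is that disjoint pieces arise by subtracting from each set of a chain the
  union of the earlier ones, which must be closed at limit steps too. At a regular cardinal
  nonstationarity of the bad indices provides such a chain. A singular cardinal has no usable
  pressing down, so there continuity is built in by bookkeeping along a short cofinal set.\<close>

locale strict_order_on =
  fixes K :: "'k set" and lt :: "'k \<Rightarrow> 'k \<Rightarrow> bool" (infix "\<sqsubset>" 50)
  assumes nonempty: "K \<noteq> {}"
    and lt_in: "x \<sqsubset> y \<Longrightarrow> x \<in> K \<and> y \<in> K"
    and lt_irrefl: "\<not> x \<sqsubset> x"
    and lt_trans: "x \<sqsubset> y \<Longrightarrow> y \<sqsubset> z \<Longrightarrow> x \<sqsubset> z"
    and lt_total: "x \<in> K \<Longrightarrow> y \<in> K \<Longrightarrow> x \<sqsubset> y \<or> x = y \<or> y \<sqsubset> x"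
begin

text \<open>List arguments let one operation carry constants, unary functions and parameters at
  once; in particular \<open>c []\<close> lies below every closed point.\<close>

definition closed_pt :: "('k list \<Rightarrow> 'k) \<Rightarrow> 'k \<Rightarrow> bool" where
  "closed_pt c i \<longleftrightarrow> (\<forall>xs. (\<forall>x\<in>set xs. x \<sqsubset> i) \<longrightarrow> c xs \<sqsubset> i)"

text \<open>On a regular uncountable cardinal this is the usual notion of a stationary set. With finitary
  operations in place of clubs it makes sense, and Fodor's lemma holds, on every linear order.\<close>

definition stat :: "'k set \<Rightarrow> bool" where
  "stat S \<longleftrightarrow> S \<subseteq> K \<and> (\<forall>c. range c \<subseteq> K \<longrightarrow> (\<exists>i\<in>S. closed_pt c i))"

definition larger :: "'k \<Rightarrow> 'k \<Rightarrow> 'k" where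
  "larger a b = (if a \<sqsubset> b then b else a)"

lemma larger_in: "a \<in> K \<Longrightarrow> b \<in> K \<Longrightarrow> larger a b \<in> K"
  by (simp add: larger_def)

lemma larger_lt_iff: "a \<in> K \<Longrightarrow> b \<in> K \<Longrightarrow> larger a b \<sqsubset> i \<longleftrightarrow> a \<sqsubset> i \<and> b \<sqsubset> i"
  unfolding larger_def using lt_trans[of a b i] lt_trans[of b a i] lt_total[of a b] by auto

text \<open>The counterpart of intersecting two clubs: a maximum lies below \<open>i\<close> exactly
  when both values do.\<close>

lemma closed_pt_larger:
  assumes "range c \<subseteq> K" "range c' \<subseteq> K"
  shows "closed_pt (\<lambda>xs. larger (c xs) (c' xs)) i \<longleftrightarrow> closed_pt c i \<and> closed_pt c' i"
proof -
  have "larger (c xs) (c' xs) \<sqsubset> i \<longleftrightarrow> c xs \<sqsubset> i \<and> c' xs \<sqsubset> i" for xs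
    using assms by (intro larger_lt_iff) auto
  then show ?thesis
    unfolding closed_pt_def by blast
qed

lemma range_larger: "range c \<subseteq> K \<Longrightarrow> range c' \<subseteq> K \<Longrightarrow> range (\<lambda>xs. larger (c xs) (c' xs)) \<subseteq> K"
  by (auto intro!: larger_in)

lemma stat_subset: "stat S \<Longrightarrow> S \<subseteq> K"
  by (simp add: stat_def)

lemma stat_mono: "stat S \<Longrightarrow> S \<subseteq> S' \<Longrightarrow> S' \<subseteq> K \<Longrightarrow> stat S'"
  unfolding stat_def by blast

lemma stat_closed:
  assumes S: "stat S" and c: "range c \<subseteq> K"
  shows "stat {i \<in> S. closed_pt c i}"
  unfolding stat_def
proof (intro conjI allI impI)
  show "{i \<in> S. closed_pt c i} \<subseteq> K"
    using S stat_subset by blast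
  fix c' :: "'k list \<Rightarrow> 'k" assume c': "range c' \<subseteq> K"
  have "\<exists>i\<in>S. closed_pt (\<lambda>xs. larger (c xs) (c' xs)) i"
    using S range_larger[OF c c'] unfolding stat_def by blast
  then show "\<exists>i\<in>{i \<in> S. closed_pt c i}. closed_pt c' i"
    using closed_pt_larger[OF c c'] by blast
qed

text \<open>Nonstationary sets form an ideal.\<close>

lemma stat_split:
  assumes S: "stat S"
  shows "stat {i \<in> S. P i} \<or> stat {i \<in> S. \<not> P i}"
proof (rule ccontr)
  assume n: "\<not> ?thesis"
  have bad: "\<exists>c. range c \<subseteq> K \<and> \<not> (\<exists>i\<in>S'. closed_pt c i)" if "\<not> stat S'" "S' \<subseteq> S" for S'
    using that stat_subset[OF S] unfolding stat_def by blast
  obtain c where c: "range c \<subseteq> K" "\<not> (\<exists>i\<in>{i \<in> S. P i}. closed_pt c i)"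
    using bad[of "{i \<in> S. P i}"] n by blast
  moreover obtain c' where c': "range c' \<subseteq> K" "\<not> (\<exists>i\<in>{i \<in> S. \<not> P i}. closed_pt c' i)"
    using bad[of "{i \<in> S. \<not> P i}"] n by blast
  moreover obtain i where "i \<in> {i \<in> S. closed_pt c i}" "closed_pt c' i"
    using stat_closed[OF S c(1)] c'(1) unfolding stat_def by blast
  ultimately show False
    by blast
qed

lemma stat_above:
  assumes S: "stat S" and a: "a \<in> K"
  shows "stat {i \<in> S. a \<sqsubset> i}"
proof (rule stat_mono)
  show "stat {i \<in> S. closed_pt (\<lambda>_. a) i}"
    using a by (intro stat_closed[OF S]) auto
  show "{i \<in> S. closed_pt (\<lambda>_. a) i} \<subseteq> {i \<in> S. a \<sqsubset> i}"
  proof clarify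
    fix i assume "closed_pt (\<lambda>_. a) i"
    then show "a \<sqsubset> i"
      unfolding closed_pt_def by (metis empty_iff empty_set)
  qed
qed (use stat_subset[OF S] in auto)

lemma stat_nonempty: "stat S \<Longrightarrow> \<exists>i. i \<in> S"
proof -
  assume S: "stat S"
  obtain a where "a \<in> K"
    using nonempty by blast
  then have "range (\<lambda>_::'k list. a) \<subseteq> K"
    by auto
  then show "\<exists>i. i \<in> S"
    using S unfolding stat_def by blast
qed

lemma stat_unbounded: "stat S \<Longrightarrow> a \<in> K \<Longrightarrow> \<exists>i\<in>S. a \<sqsubset> i"
  using stat_nonempty[OF stat_above] by blast

text \<open>A relation \<open>R\<close> in place of a regressive function spares the callers a
  choice.\<close>

lemma fodor:
  assumes S: "stat S" and R: "\<And>i. i \<in> S \<Longrightarrow> \<exists>j. j \<sqsubset> i \<and> R i j"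
  shows "\<exists>p\<in>K. stat {i \<in> S. R i p}"
proof (rule ccontr)
  assume "\<not> ?thesis"
  then have "\<forall>p. p \<in> K \<longrightarrow> (\<exists>c. range c \<subseteq> K \<and> \<not> (\<exists>i\<in>{i \<in> S. R i p}. closed_pt c i))"
    using stat_subset[OF S] unfolding stat_def by blast
  then obtain c where c: "\<And>p. p \<in> K \<Longrightarrow> range (c p) \<subseteq> K"
    "\<And>p. p \<in> K \<Longrightarrow> \<not> (\<exists>i\<in>{i \<in> S. R i p}. closed_pt (c p) i)"
    by metis
  obtain a where a: "a \<in> K"
    using nonempty by blast
  \<comment> \<open>Diagonal intersection: the head of the list selects the operation, so a point
    closed under \<open>d\<close> is closed under \<open>c p\<close> for every earlier
    \<open>p\<close>.\<close>
  define d where "d xs = (case xs of [] \<Rightarrow> a | p # ys \<Rightarrow> if p \<in> K then c p ys else a)" for xs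
  have "range d \<subseteq> K"
  proof clarify
    fix xs show "d xs \<in> K"
      using a c(1) by (cases xs) (auto simp: d_def image_subset_iff)
  qed
  then obtain i where i: "i \<in> S" "closed_pt d i"
    using S unfolding stat_def by blast
  obtain p where p: "p \<sqsubset> i" "R i p"
    using R[OF i(1)] by blast
  have "p \<in> K"
    using p lt_in by blast
  moreover have "closed_pt (c p) i"
    unfolding closed_pt_def
  proof (intro allI impI)
    fix xs assume "\<forall>x\<in>set xs. x \<sqsubset> i"
    then have "d (p # xs) \<sqsubset> i"
      using i(2)[unfolded closed_pt_def, rule_format, of "p # xs"] p(1) by auto
    then show "c p xs \<sqsubset> i"
      using \<open>p \<in> K\<close> by (simp add: d_def)
  qed
  ultimately show False
    using c(2) i(1) p(2) by blast
qed

end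

section \<open>Uniform structure of nabla products\<close>

text \<open>\<open>D a b\<close> stands for the sequence of coordinatewise distances between fixed
  representatives of two classes. Only large \<open>n\<close> count, hence separation at infinitely
  many coordinates and neighbourhoods given by eventual bounds.\<close>

locale nabla_space =
  fixes Y :: "'p topology" and D :: "'p \<Rightarrow> 'p \<Rightarrow> nat \<Rightarrow> real"
  assumes D_nonneg: "0 \<le> D a b n"
    and D_commute: "D a b n = D b a n"
    and D_self: "a \<in> topspace Y \<Longrightarrow> D a a n = 0"
    and D_triangle: "a \<in> topspace Y \<Longrightarrow> b \<in> topspace Y \<Longrightarrow> c \<in> topspace Y \<Longrightarrow>
          D a c n \<le> D a b n + D b c n"
    and D_sep: "a \<in> topspace Y \<Longrightarrow> b \<in> topspace Y \<Longrightarrow> a \<noteq> b \<Longrightarrow>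
          \<exists>\<^sub>F n in sequentially. 0 < D a b n"
    and openin_iff: "openin Y U \<longleftrightarrow> U \<subseteq> topspace Y \<and>
          (\<forall>a\<in>U. \<exists>g. (\<forall>n. 0 < g n) \<and>
             {b \<in> topspace Y. \<forall>\<^sub>F n in sequentially. D a b n < g n} \<subseteq> U)"
begin

definition nbhd :: "'p \<Rightarrow> (nat \<Rightarrow> real) \<Rightarrow> 'p set" where
  "nbhd a g = {b \<in> topspace Y. \<forall>\<^sub>F n in sequentially. D a b n < g n}"

lemma nbhd_in_open:
  "openin Y U \<Longrightarrow> a \<in> U \<Longrightarrow> \<exists>g. (\<forall>n. 0 < g n) \<and> nbhd a g \<subseteq> U"
  unfolding nbhd_def using openin_iff[of U] by blast

lemma mem_nbhd: "a \<in> topspace Y \<Longrightarrow> (\<And>n. 0 < g n) \<Longrightarrow> a \<in> nbhd a g"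
  by (simp add: nbhd_def D_self)

lemma openin_nbhd:
  assumes a: "a \<in> topspace Y"
  shows "openin Y (nbhd a g)"
  unfolding openin_iff
proof (intro conjI ballI)
  fix b assume b: "b \<in> nbhd a g"
  \<comment> \<open>The value 1 only keeps \<open>h\<close> positive at the finitely many
    \<open>n\<close> where the bound fails.\<close>
  define h where "h n = (if D a b n < g n then g n - D a b n else 1)" for n
  have "{c \<in> topspace Y. \<forall>\<^sub>F n in sequentially. D b c n < h n} \<subseteq> nbhd a g"
  proof clarify
    fix c assume c: "c \<in> topspace Y" "\<forall>\<^sub>F n in sequentially. D b c n < h n"
    have "\<forall>\<^sub>F n in sequentially. D a b n < g n"
      using b by (simp add: nbhd_def)
    then have "\<forall>\<^sub>F n in sequentially. D a c n < g n"
      using c(2)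
    proof eventually_elim
      case (elim n)
      then show ?case
        using D_triangle[of a b c n] a b c(1) by (simp add: h_def nbhd_def)
    qed
    then show "c \<in> nbhd a g"
      using c by (simp add: nbhd_def)
  qed
  moreover have "\<forall>n. 0 < h n"
    by (simp add: h_def)
  ultimately show "\<exists>h. (\<forall>n. 0 < h n) \<and>
      {c \<in> topspace Y. \<forall>\<^sub>F n in sequentially. D b c n < h n} \<subseteq> nbhd a g"
    by blast
qed (auto simp: nbhd_def)

lemma openin_Inter_seq:
  fixes U :: "nat \<Rightarrow> 'p set"
  assumes U: "\<And>k. openin Y (U k)"
  shows "openin Y (\<Inter>k. U k)"
  unfolding openin_iff
proof (intro conjI ballI)
  show "(\<Inter>k. U k) \<subseteq> topspace Y"
    using openin_subset[OF U[of 0]] by auto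
  fix a assume "a \<in> (\<Inter>k. U k)"
  then have "\<forall>k. \<exists>g. (\<forall>n. 0 < g n) \<and> nbhd a g \<subseteq> U k"
    using nbhd_in_open[OF U] by blast
  then obtain g where g: "\<And>k n. 0 < g k n" "\<And>k. nbhd a (g k) \<subseteq> U k"
    by metis
  \<comment> \<open>Diagonal minimum: \<open>h n\<close> is at most \<open>g k n\<close> as soon as
    \<open>n\<close> reaches \<open>k\<close>, and finitely many coordinates are ignored.\<close>
  define h where "h n = Min ((\<lambda>k. g k n) ` {..n})" for n
  have "0 < h n" for n
    unfolding h_def using g(1) by (subst Min_gr_iff) auto
  moreover have "nbhd a h \<subseteq> U k" for k
  proof -
    have "\<forall>\<^sub>F n in sequentially. D a b n < g k n" if "\<forall>\<^sub>F n in sequentially. D a b n < h n" for b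
      using that eventually_ge_at_top[of k]
    proof eventually_elim
      case (elim n)
      have "h n \<le> g k n"
        unfolding h_def using elim by (intro Min_le) auto
      then show ?case
        using elim by simp
    qed
    then have "nbhd a h \<subseteq> nbhd a (g k)"
      by (auto simp: nbhd_def)
    then show ?thesis
      using g(2) by blast
  qed
  ultimately show "\<exists>h. (\<forall>n. 0 < h n) \<and>
      {b \<in> topspace Y. \<forall>\<^sub>F n in sequentially. D a b n < h n} \<subseteq> (\<Inter>k. U k)"
    unfolding nbhd_def by blast
qed

lemma openin_delete:
  assumes "a \<in> topspace Y"
  shows "openin Y (topspace Y - {a})"
  unfolding openin_iff
proof (intro conjI ballI)
  fix b assume b: "b \<in> topspace Y - {a}"
  define g where "g n = (if 0 < D b a n then D b a n else 1)" for n
  have "\<exists>\<^sub>F n in sequentially. 0 < D b a n"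
    using D_sep[of b a] assms b by blast
  then have "\<exists>\<^sub>F n in sequentially. \<not> D b a n < g n"
    by (rule frequently_elim1) (simp add: g_def)
  then have "{c \<in> topspace Y. \<forall>\<^sub>F n in sequentially. D b c n < g n} \<subseteq> topspace Y - {a}"
    by (auto simp: frequently_def)
  moreover have "\<forall>n. 0 < g n"
    by (simp add: g_def)
  ultimately show "\<exists>g. (\<forall>n. 0 < g n) \<and>
      {c \<in> topspace Y. \<forall>\<^sub>F n in sequentially. D b c n < g n} \<subseteq> topspace Y - {a}"
    by blast
qed auto

end

locale nabla_index = nabla_space Y D + strict_order_on K lt
  for Y :: "'p topology" and D and K :: "'k set" and lt (infix "\<sqsubset>" 50)
begin

text \<open>The hypothesis \<open>press\<close> makes \<open>x\<close> a Cauchy sequence (\<open>tail\<close>). If it converged to a point \<open>w\<close>, then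
  the set \<open>{n. x b n \<noteq> w n}\<close> and the distance of \<open>x b\<close> from \<open>w\<close> would play the role of \<open>E b\<close> and \<open>f b\<close> in the
  proof. There need not be a limit, but pressing down once for each \<open>b\<close> provides a substitute, namely
  a largest set on which \<open>x b\<close> stays away from the tail of the sequence (\<open>max_far\<close>).\<close>

lemma no_thread:
  assumes T: "stat T" and x: "\<And>i. i \<in> T \<Longrightarrow> x i \<in> topspace Y"
    and inj: "\<And>i j. i \<in> T \<Longrightarrow> j \<in> T \<Longrightarrow> i \<sqsubset> j \<Longrightarrow> x i \<noteq> x j"
    and press: "\<And>N. (\<And>j. j \<in> T \<Longrightarrow> openin Y (N j) \<and> x j \<in> N j) \<Longrightarrow>
        \<exists>S q. stat S \<and> S \<subseteq> T \<and> q \<in> T \<and> (\<forall>j\<in>S. \<forall>i\<in>T. q \<sqsubset> i \<and> i \<sqsubset> j \<longrightarrow> x i \<in> N j)"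
  shows False
proof -
  have TK: "i \<in> K" if "i \<in> T" for i
    using stat_subset[OF T] that by blast
  have tri: "D (x i) (x k) n \<le> D (x i) (x j) n + D (x j) (x k) n"
    if "i \<in> T" "j \<in> T" "k \<in> T" for i j k n
    using D_triangle x that by blast
  have press': "\<exists>S q. stat S \<and> S \<subseteq> T \<and> q \<in> T \<and>
      (\<forall>j\<in>S. \<forall>i\<in>T. q \<sqsubset> i \<and> i \<sqsubset> j \<longrightarrow> (\<forall>\<^sub>F n in sequentially. D (x j) (x i) n < g j n))"
    if g: "\<And>j n. j \<in> T \<Longrightarrow> 0 < g j n" for g
  proof -
    have "\<exists>S q. stat S \<and> S \<subseteq> T \<and> q \<in> T \<and>
        (\<forall>j\<in>S. \<forall>i\<in>T. q \<sqsubset> i \<and> i \<sqsubset> j \<longrightarrow> x i \<in> nbhd (x j) (g j))"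
      by (rule press) (simp add: openin_nbhd mem_nbhd x g)
    then show ?thesis
      by (simp add: nbhd_def) blast
  qed
  \<comment> \<open>Two late terms are compared through a common later \<open>x k\<close> with
    \<open>k\<close> in \<open>S\<close>, within \<open>g / 2\<close> of both.\<close>
  have tail: "\<exists>q\<in>T. \<forall>i\<in>T. \<forall>j\<in>T. q \<sqsubset> i \<and> q \<sqsubset> j \<longrightarrow>
      (\<forall>\<^sub>F n in sequentially. D (x i) (x j) n < g n)" if g: "\<And>n. 0 < g n" for g
  proof -
    obtain S q where S: "stat S" "S \<subseteq> T" "q \<in> T"
      "\<And>j i. \<lbrakk>j \<in> S; i \<in> T; q \<sqsubset> i; i \<sqsubset> j\<rbrakk> \<Longrightarrow> \<forall>\<^sub>F n in sequentially. D (x j) (x i) n < g n / 2"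
      using press'[of "\<lambda>_ n. g n / 2"] g by auto
    have "\<forall>\<^sub>F n in sequentially. D (x i) (x j) n < g n"
      if ij: "i \<in> T" "j \<in> T" "q \<sqsubset> i" "q \<sqsubset> j" for i j
    proof -
      obtain k where k: "k \<in> S" "larger i j \<sqsubset> k"
        using stat_unbounded[OF S(1) larger_in] TK ij by blast
      then have kij: "i \<sqsubset> k" "j \<sqsubset> k"
        using larger_lt_iff TK ij by blast+
      have "\<forall>\<^sub>F n in sequentially. D (x k) (x i) n < g n / 2"
        "\<forall>\<^sub>F n in sequentially. D (x k) (x j) n < g n / 2"
        using S(4) k kij ij by blast+
      then show ?thesis
      proof eventually_elim
        case (elim n)
        then show ?case
          using tri[of i k j n] ij k S(2) D_commute[of "x i" "x k" n] by auto
      qed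
    qed
    then show ?thesis
      using S(3) by blast
  qed
  define far where "far b E f \<longleftrightarrow> (\<exists>q\<in>T. \<forall>d\<in>T. q \<sqsubset> d \<longrightarrow>
      (\<forall>\<^sub>F n in sequentially. n \<in> E \<longrightarrow> f n \<le> D (x b) (x d) n))" for b E and f :: "nat \<Rightarrow> real"
  have max_far: "\<exists>E f. (\<forall>n. 0 < f n) \<and> far b E f \<and>
      (\<forall>E' f'. (\<forall>n. 0 < f' n) \<and> far b E' f' \<longrightarrow> (\<forall>\<^sub>F n in sequentially. n \<in> E' \<longrightarrow> n \<in> E))"
    if b: "b \<in> T" for b
  proof -
    \<comment> \<open>Each radius is relative to the distance from \<open>x b\<close>. So one fixed
      \<open>x i\<close> has, wherever a late \<open>x j\<close> with \<open>j\<close> in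
      \<open>S\<close> differs from \<open>x b\<close>, nearly the same distance from
      \<open>x b\<close> as \<open>x j\<close>. The fraction 1/8 leaves room for two such
      approximations and the threshold 1/2 in \<open>E\<close>.\<close>
    define g where "g j n = (if 0 < D (x j) (x b) n then D (x j) (x b) n / 8 else 1)" for j n
    have g: "0 < g j n" for j n
      by (simp add: g_def)
    obtain S q where S: "stat S" "S \<subseteq> T" "q \<in> T"
      "\<And>j i. \<lbrakk>j \<in> S; i \<in> T; q \<sqsubset> i; i \<sqsubset> j\<rbrakk> \<Longrightarrow> \<forall>\<^sub>F n in sequentially. D (x j) (x i) n < g j n"
      using press'[of g] g by auto
    obtain i where i: "i \<in> T" "q \<sqsubset> i"
      using stat_unbounded[OF T] TK S(3) by blast
    obtain q1 where q1: "q1 \<in> T" "\<And>k j. \<lbrakk>k \<in> T; j \<in> T; q1 \<sqsubset> k; q1 \<sqsubset> j\<rbrakk> \<Longrightarrow>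
        \<forall>\<^sub>F n in sequentially. D (x k) (x j) n < g i n"
      using tail[of "g i"] g by auto
    obtain d0 where d0: "d0 \<in> T" "q1 \<sqsubset> d0"
      using stat_unbounded[OF T] TK q1(1) by blast
    \<comment> \<open>On \<open>E\<close> late terms stay at least 1/2 - 1/8 of
      \<open>D (x i) (x b)\<close> away from \<open>x b\<close>, more than \<open>f\<close> asks. A
      competing \<open>E'\<close> lies in \<open>E\<close> up to finitely many coordinates, because
      there a late \<open>x j\<close> shares the scale of \<open>x i\<close>.\<close>
    define E where "E = {n. 0 < D (x i) (x b) n \<and> D (x i) (x b) n / 2 \<le> D (x d0) (x b) n}"
    define f where "f n = (if 0 < D (x i) (x b) n then D (x i) (x b) n / 4 else 1)" for n
    have "0 < f n" for n
      by (simp add: f_def)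
    moreover have "far b E f"
      unfolding far_def
    proof (intro bexI[OF _ q1(1)] ballI impI)
      fix d assume d: "d \<in> T" "q1 \<sqsubset> d"
      show "\<forall>\<^sub>F n in sequentially. n \<in> E \<longrightarrow> f n \<le> D (x b) (x d) n"
        using q1(2)[OF d0(1) d(1) d0(2) d(2)]
      proof eventually_elim
        case (elim n)
        then show ?case
          using tri[of d0 d b n] d d0 b D_commute[of "x b" "x d" n] by (auto simp: E_def f_def g_def)
      qed
    qed
    moreover have "\<forall>\<^sub>F n in sequentially. n \<in> E' \<longrightarrow> n \<in> E"
      if f': "\<And>n. 0 < f' n" and far': "far b E' f'" for E' f'
    proof -
      obtain q2 where q2: "q2 \<in> T" "\<And>d. d \<in> T \<Longrightarrow> q2 \<sqsubset> d \<Longrightarrow>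
          \<forall>\<^sub>F n in sequentially. n \<in> E' \<longrightarrow> f' n \<le> D (x b) (x d) n"
        using far' unfolding far_def by blast
      obtain j where j: "j \<in> S" "larger (larger q1 q2) i \<sqsubset> j"
        using stat_unbounded[OF S(1) larger_in[OF larger_in]] TK q1(1) q2(1) i(1) by blast
      then have j': "q1 \<sqsubset> j" "q2 \<sqsubset> j" "i \<sqsubset> j" "j \<in> T"
        using larger_lt_iff larger_in TK q1(1) q2(1) i(1) S(2) by auto
      show ?thesis
        using q2(2)[OF j'(4,2)] S(4)[OF j(1) i j'(3)] q1(2)[OF j'(4) d0(1) j'(1) d0(2)]
      proof eventually_elim
        case (elim n)
        show ?case
        proof
          assume n: "n \<in> E'"
          have pos: "0 < D (x j) (x b) n"
            using elim(1) n f'[of n] D_commute[of "x b" "x j" n] by auto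
          then have *: "D (x j) (x i) n < D (x j) (x b) n / 8"
            using elim(2) by (simp add: g_def)
          have t: "D (x i) (x b) n \<le> D (x j) (x i) n + D (x j) (x b) n"
              "D (x j) (x b) n \<le> D (x j) (x i) n + D (x i) (x b) n"
              "D (x j) (x b) n \<le> D (x j) (x d0) n + D (x d0) (x b) n"
            using tri[of i j b n] tri[of j i b n] tri[of j d0 b n] i b j' d0
              D_commute[of "x j" "x i" n] by auto
          have pos': "0 < D (x i) (x b) n"
            using t(2) * pos by linarith
          then have "D (x j) (x d0) n < D (x i) (x b) n / 8"
            using elim(3) by (simp add: g_def)
          then show "n \<in> E"
            unfolding E_def using pos' t * by simp
        qed
      qed
    qed
    ultimately show ?thesis
      by blast
  qed
  define Q where "Q b E f \<longleftrightarrow> (\<forall>n. 0 < f n) \<and> far b E f \<and>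
      (\<forall>E' f'. (\<forall>n. 0 < f' n) \<and> far b E' f' \<longrightarrow>
        (\<forall>\<^sub>F n in sequentially. n \<in> E' \<longrightarrow> n \<in> E))" for b E f
  have "\<forall>b\<in>T. \<exists>E f. Q b E f"
    unfolding Q_def using max_far by simp
  then obtain E f where Q: "\<And>b. b \<in> T \<Longrightarrow> Q b (E b) (f b)"
    by metis
  have f: "0 < f b n" if "b \<in> T" for b n
    using Q[OF that] by (simp add: Q_def)
  have farE: "far b (E b) (f b)" if "b \<in> T" for b
    using Q[OF that] by (simp add: Q_def)
  have maxE: "\<forall>\<^sub>F n in sequentially. n \<in> E' \<longrightarrow> n \<in> E b"
    if "b \<in> T" "\<And>n. 0 < f' n" "far b E' f'" for b E' f'
    using Q[OF that(1)] that(2,3) unfolding Q_def by blast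
  \<comment> \<open>An eighth of the distance from the tail: an earlier term this near to
    \<open>x j\<close> is still away from the tail wherever \<open>x j\<close> is.\<close>
  define g where "g j n = f j n / 8" for j n
  have g: "0 < g j n" if "j \<in> T" for j n
    using f[OF that] by (simp add: g_def)
  obtain S q where S: "stat S" "S \<subseteq> T" "q \<in> T"
    "\<And>j i. \<lbrakk>j \<in> S; i \<in> T; q \<sqsubset> i; i \<sqsubset> j\<rbrakk> \<Longrightarrow> \<forall>\<^sub>F n in sequentially. D (x j) (x i) n < g j n"
    using press'[of g] g by auto
  obtain b where b: "b \<in> T" "q \<sqsubset> b"
    using stat_unbounded[OF T] TK S(3) by blast
  obtain q1 where q1: "q1 \<in> T" "\<And>k j. \<lbrakk>k \<in> T; j \<in> T; q1 \<sqsubset> k; q1 \<sqsubset> j\<rbrakk> \<Longrightarrow>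
      \<forall>\<^sub>F n in sequentially. D (x k) (x j) n < g b n"
    using tail[of "g b"] g[OF b(1)] by blast
  obtain q2 where q2: "q2 \<in> T" "\<And>d. d \<in> T \<Longrightarrow> q2 \<sqsubset> d \<Longrightarrow>
      \<forall>\<^sub>F n in sequentially. n \<in> E b \<longrightarrow> f b n \<le> D (x b) (x d) n"
    using farE[OF b(1)] unfolding far_def by blast
  define m where "m = larger (larger q1 q2) b"
  have m: "m \<in> K" "\<And>d. m \<sqsubset> d \<longleftrightarrow> q1 \<sqsubset> d \<and> q2 \<sqsubset> d \<and> b \<sqsubset> d"
    unfolding m_def using larger_in larger_lt_iff TK q1(1) q2(1) b(1) by auto
  \<comment> \<open>By maximality \<open>E a\<close> lies in \<open>E b\<close> up to finitely many
    coordinates, and there the bounds collide: \<open>f a \<le> D (x a) (x d) < f b / 8 \<le> D (x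
    b) (x a) / 8 < f a / 64\<close>.\<close>
  have small: "\<forall>\<^sub>F n in sequentially. n \<notin> E a" if a: "a \<in> S" "m \<sqsubset> a" for a
  proof -
    have aT: "a \<in> T"
      using a S(2) by blast
    obtain q3 where q3: "q3 \<in> T" "\<And>d. d \<in> T \<Longrightarrow> q3 \<sqsubset> d \<Longrightarrow>
        \<forall>\<^sub>F n in sequentially. n \<in> E a \<longrightarrow> f a n \<le> D (x a) (x d) n"
      using farE[OF aT] unfolding far_def by blast
    have ab: "\<forall>\<^sub>F n in sequentially. D (x a) (x b) n < g a n"
      using S(4)[OF a(1) b] a(2) m(2) by blast
    have "far b (E a) (g a)"
      unfolding far_def
    proof (intro bexI[OF _ q3(1)] ballI impI)
      fix d assume d: "d \<in> T" "q3 \<sqsubset> d"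
      show "\<forall>\<^sub>F n in sequentially. n \<in> E a \<longrightarrow> g a n \<le> D (x b) (x d) n"
        using q3(2)[OF d] ab
      proof eventually_elim
        case (elim n)
        then show ?case
          using tri[of a b d n] aT b(1) d(1) f[OF aT, of n] by (auto simp: g_def)
      qed
    qed
    then have sub: "\<forall>\<^sub>F n in sequentially. n \<in> E a \<longrightarrow> n \<in> E b"
      using maxE[OF b(1)] g[OF aT] by blast
    obtain d where d: "d \<in> T" "larger m q3 \<sqsubset> d"
      using stat_unbounded[OF T larger_in] m(1) q3(1) TK by blast
    then have d': "q1 \<sqsubset> d" "q3 \<sqsubset> d"
      using larger_lt_iff m q3(1) TK by auto
    have a': "q1 \<sqsubset> a" "q2 \<sqsubset> a"
      using a m by auto
    show ?thesis
      using sub ab q3(2)[OF d(1) d'(2)] q2(2)[OF aT a'(2)] q1(2)[OF aT d(1) a'(1) d'(1)]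
    proof eventually_elim
      case (elim n)
      then show ?case
        using D_commute[of "x a" "x b" n] f[OF b(1), of n] by (auto simp: g_def)
    qed
  qed
  obtain a where a: "a \<in> S" "m \<sqsubset> a"
    using stat_unbounded[OF S(1) m(1)] by blast
  obtain c where c: "c \<in> S" "a \<sqsubset> c"
    using stat_unbounded[OF S(1)] a TK S(2) by blast
  have ac: "a \<in> T" "c \<in> T" "m \<sqsubset> c"
    using a c S(2) lt_trans by blast+
  define h where "h n = (if 0 < D (x a) (x c) n then D (x a) (x c) n / 8 else 1)" for n
  have h: "0 < h n" for n
    by (simp add: h_def)
  obtain q4 where q4: "q4 \<in> T" "\<And>k j. \<lbrakk>k \<in> T; j \<in> T; q4 \<sqsubset> k; q4 \<sqsubset> j\<rbrakk> \<Longrightarrow>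
      \<forall>\<^sub>F n in sequentially. D (x k) (x j) n < h n"
    using tail[of h] h by blast
  obtain d0 where d0: "d0 \<in> T" "q4 \<sqsubset> d0"
    using stat_unbounded[OF T] TK q4(1) by blast
  \<comment> \<open>Wherever \<open>x a\<close> and \<open>x c\<close> differ, a late term is at
    least half their distance from one of them. As \<open>E a\<close> and \<open>E c\<close> are
    finite, this can happen at finitely many coordinates only.\<close>
  define C where "C i = {n. 0 < D (x a) (x c) n \<and> D (x a) (x c) n / 2 \<le> D (x i) (x d0) n}" for i
  have farC: "far i (C i) h" if "i \<in> T" for i
    unfolding far_def
  proof (intro bexI[OF _ q4(1)] ballI impI)
    fix d assume d: "d \<in> T" "q4 \<sqsubset> d"
    show "\<forall>\<^sub>F n in sequentially. n \<in> C i \<longrightarrow> h n \<le> D (x i) (x d) n"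
      using q4(2)[OF d(1) d0(1) d(2) d0(2)]
    proof eventually_elim
      case (elim n)
      then show ?case
        using tri[of i d d0 n] that d(1) d0(1) by (auto simp: C_def h_def)
    qed
  qed
  have "\<forall>\<^sub>F n in sequentially. \<not> 0 < D (x a) (x c) n"
    using maxE[OF ac(1) h farC[OF ac(1)]] maxE[OF ac(2) h farC[OF ac(2)]]
      small[OF a] small[OF c(1) ac(3)]
  proof eventually_elim
    case (elim n)
    then have "n \<notin> C a" "n \<notin> C c"
      by auto
    then show ?case
      using tri[of a d0 c n] ac d0(1) D_commute[of "x c" "x d0" n] by (auto simp: C_def)
  qed
  moreover have "\<exists>\<^sub>F n in sequentially. 0 < D (x a) (x c) n"
    using D_sep[OF x[OF ac(1)] x[OF ac(2)]] inj[OF ac(1,2) c(2)] by blast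
  ultimately show False
    by (simp add: frequently_def)
qed

end

section \<open>Monotone normality\<close>

text \<open>\<open>G\<close> is a monotone normality operator; \<open>N\<close> picks for each point
  a member of the open cover to be refined.\<close>

locale mn_nabla_space = nabla_space Y D
  for Y :: "'p topology" and D +
  fixes G :: "'p \<Rightarrow> 'p set \<Rightarrow> 'p set" and N :: "'p \<Rightarrow> 'p set"
  assumes G: "openin Y U \<Longrightarrow> x \<in> U \<Longrightarrow> openin Y (G x U) \<and> x \<in> G x U \<and> G x U \<subseteq> U"
    and G_meet: "openin Y U \<Longrightarrow> x \<in> U \<Longrightarrow> openin Y V \<Longrightarrow> y \<in> V \<Longrightarrow>
          G x U \<inter> G y V \<noteq> {} \<Longrightarrow> x \<in> V \<or> y \<in> U"
    and N: "x \<in> topspace Y \<Longrightarrow> openin Y (N x) \<and> x \<in> N x"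
begin

text \<open>Countable intersections of open sets are open, so the operator can be iterated \<open>\<omega>\<close> times.
  The gain over \<open>G\<close> is \<open>G_Int_H\<close>: neighbourhoods of outside points miss all of \<open>H y\<close>.\<close>

definition H :: "'p \<Rightarrow> 'p set" where
  "H y = (\<Inter>n. (G y ^^ n) (N y))"

lemma G_funpow: "y \<in> topspace Y \<Longrightarrow> openin Y ((G y ^^ n) (N y)) \<and> y \<in> (G y ^^ n) (N y)"
  by (induction n) (auto simp: N G)

lemma openin_H: "y \<in> topspace Y \<Longrightarrow> openin Y (H y)"
  unfolding H_def by (intro openin_Inter_seq) (simp add: G_funpow)

lemma mem_H: "y \<in> topspace Y \<Longrightarrow> y \<in> H y"
  by (simp add: H_def G_funpow)

lemma H_subset: "H y \<subseteq> N y"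
  unfolding H_def by (metis INT_lower UNIV_I funpow_0)

lemma G_Int_H:
  assumes y: "y \<in> topspace Y" "y \<notin> W" and x: "openin Y W" "x \<in> W" "x \<notin> H y"
  shows "G x W \<inter> H y = {}"
proof -
  \<comment> \<open>The point \<open>x\<close> drops out at a finite stage, and \<open>H y\<close>
    lies in \<open>G\<close> of that very stage, so \<open>G_meet\<close> applies.\<close>
  obtain n where n: "x \<notin> (G y ^^ n) (N y)"
    using x(3) by (auto simp: H_def)
  have "H y \<subseteq> (G y ^^ Suc n) (N y)"
    unfolding H_def by (rule INT_lower) simp
  then have "H y \<subseteq> G y ((G y ^^ n) (N y))"
    by simp
  then show ?thesis
    using G_meet[OF x(1,2), of "(G y ^^ n) (N y)" y] G_funpow[OF y(1)] n y(2) by blast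
qed

section \<open>Closedness of unions of the neighbourhoods \<open>H y\<close>\<close>

definition V :: "'p set \<Rightarrow> 'p set" where
  "V X = (\<Union>y\<in>X. H y)"

definition V_closed :: "'p set \<Rightarrow> bool" where
  "V_closed X \<longleftrightarrow> openin Y (topspace Y - V X)"

lemma openin_V: "X \<subseteq> topspace Y \<Longrightarrow> openin Y (V X)"
  unfolding V_def by (auto intro!: openin_H)

text \<open>A neighbourhood \<open>W\<close> of \<open>x\<close> missing \<open>X\<close> yields, by
  \<open>G_Int_H\<close>, the single neighbourhood \<open>G x W\<close> missing all
  \<open>H y\<close> at once.\<close>

lemma not_V_closedD:
  assumes X: "X \<subseteq> topspace Y" and "\<not> V_closed X"
  shows "\<exists>x\<in>topspace Y - V X. \<forall>W. openin Y W \<and> x \<in> W \<longrightarrow> (\<exists>y\<in>X. y \<in> W)"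
proof (rule ccontr)
  assume *: "\<not> ?thesis"
  have "\<exists>T. openin Y T \<and> x \<in> T \<and> T \<subseteq> topspace Y - V X" if x: "x \<in> topspace Y - V X" for x
  proof -
    have "\<not> (\<forall>W. openin Y W \<and> x \<in> W \<longrightarrow> (\<exists>y\<in>X. y \<in> W))"
    proof
      assume "\<forall>W. openin Y W \<and> x \<in> W \<longrightarrow> (\<exists>y\<in>X. y \<in> W)"
      then have "\<exists>x\<in>topspace Y - V X. \<forall>W. openin Y W \<and> x \<in> W \<longrightarrow> (\<exists>y\<in>X. y \<in> W)"
        using x by (rule bexI)
      with * show False
        by (rule notE)
    qed
    then obtain W where W: "openin Y W" "x \<in> W" "\<forall>y\<in>X. y \<notin> W"
      by auto
    then have "G x W \<inter> H y = {}" if "y \<in> X" for y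
      using that x X by (intro G_Int_H) (auto simp: V_def)
    then have "G x W \<subseteq> topspace Y - V X"
      using G[OF W(1,2)] openin_subset[OF W(1)] by (auto simp: V_def)
    then show ?thesis
      using G[OF W(1,2)] by blast
  qed
  then have "openin Y (topspace Y - V X)"
    by (subst openin_subopen) blast
  then show False
    using assms(2) by (simp add: V_closed_def)
qed

text \<open>Points are closed and countable intersections of open sets are open, so a countable set
  has no closure points outside itself.\<close>

lemma V_closed_countable:
  assumes X: "X \<subseteq> topspace Y" "countable X"
  shows "V_closed X"
proof (rule ccontr)
  assume n: "\<not> V_closed X"
  then have "X \<noteq> {}"
    by (auto simp: V_closed_def V_def)
  obtain x where x: "x \<in> topspace Y - V X"
    "\<forall>W. openin Y W \<and> x \<in> W \<longrightarrow> (\<exists>y\<in>X. y \<in> W)"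
    by (rule bexE[OF not_V_closedD[OF X(1) n]])
  let ?W = "\<Inter>k. topspace Y - {from_nat_into X k}"
  have "openin Y ?W"
    using from_nat_into[OF \<open>X \<noteq> {}\<close>] X(1) by (intro openin_Inter_seq openin_delete) auto
  moreover have "X \<subseteq> V X"
    using mem_H X(1) by (auto simp: V_def)
  then have "x \<in> ?W"
    using x(1) from_nat_into[OF \<open>X \<noteq> {}\<close>] by blast
  ultimately have "\<exists>y\<in>X. y \<in> ?W"
    using x(2)[rule_format, of ?W] by simp
  then show False
    using from_nat_into_surj[OF X(2)] by fastforce
qed

lemma V_closed_UN_seq: "(\<And>n::nat. V_closed (J n)) \<Longrightarrow> V_closed (\<Union>n. J n)"
proof -
  assume J: "\<And>n::nat. V_closed (J n)"
  have "topspace Y - V (\<Union>n. J n) = (\<Inter>n. topspace Y - V (J n))"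
    by (auto simp: V_def)
  then show ?thesis
    using J openin_Inter_seq[of "\<lambda>n. topspace Y - V (J n)"] by (simp only: V_closed_def)
qed

section \<open>Disjoint open refinements\<close>

definition good :: "'p set \<Rightarrow> bool" where
  "good Z \<longleftrightarrow> (\<exists>\<P>. (\<forall>B\<in>\<P>. openin Y B \<and> (\<exists>y\<in>topspace Y. B \<subseteq> N y)) \<and> disjoint \<P> \<and> \<Union>\<P> = Z)"

lemma good_H: "y \<in> topspace Y \<Longrightarrow> good (H y)"
  unfolding good_def using openin_H H_subset by (intro exI[of _ "{H y}"]) auto

lemma good_subset:
  assumes "good Z" "openin Y B" "B \<subseteq> Z"
  shows "good B"
proof -
  obtain \<P> where P: "\<And>C. C \<in> \<P> \<Longrightarrow> openin Y C \<and> (\<exists>y\<in>topspace Y. C \<subseteq> N y)"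
    "disjoint \<P>" "\<Union>\<P> = Z"
    using assms(1) unfolding good_def by blast
  have "\<forall>C\<in>(\<lambda>C. C \<inter> B) ` \<P>. openin Y C \<and> (\<exists>y\<in>topspace Y. C \<subseteq> N y)"
    using P(1) assms(2) by (auto intro!: openin_Int) blast
  moreover have "disjoint ((\<lambda>C. C \<inter> B) ` \<P>)"
    using P(2) unfolding disjoint_def by auto
  moreover have "\<Union>((\<lambda>C. C \<inter> B) ` \<P>) = B"
    using P(3) assms(3) by auto
  ultimately show ?thesis
    unfolding good_def by blast
qed

lemma good_disjoint_UN:
  assumes "\<And>a. a \<in> I \<Longrightarrow> good (Z a)"
    and dis: "\<And>a b. a \<in> I \<Longrightarrow> b \<in> I \<Longrightarrow> a \<noteq> b \<Longrightarrow> Z a \<inter> Z b = {}"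
  shows "good (\<Union>a\<in>I. Z a)"
proof -
  have "\<forall>a\<in>I. \<exists>\<P>. (\<forall>B\<in>\<P>. openin Y B \<and> (\<exists>y\<in>topspace Y. B \<subseteq> N y)) \<and> disjoint \<P> \<and> \<Union>\<P> = Z a"
    using assms(1) unfolding good_def by blast
  then obtain \<P> where P: "\<And>a. a \<in> I \<Longrightarrow> \<forall>B\<in>\<P> a. openin Y B \<and> (\<exists>y\<in>topspace Y. B \<subseteq> N y)"
    "\<And>a. a \<in> I \<Longrightarrow> disjoint (\<P> a)" "\<And>a. a \<in> I \<Longrightarrow> \<Union>(\<P> a) = Z a"
    by metis
  have "disjoint (\<Union>a\<in>I. \<P> a)"
    unfolding disjoint_def
  proof (intro ballI impI)
    fix B C assume "B \<in> (\<Union>a\<in>I. \<P> a)" "C \<in> (\<Union>a\<in>I. \<P> a)" "B \<noteq> C"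
    then obtain a b where ab: "a \<in> I" "B \<in> \<P> a" "b \<in> I" "C \<in> \<P> b"
      by blast
    show "B \<inter> C = {}"
    proof (cases "a = b")
      case True
      then show ?thesis
        using P(2)[OF ab(1)] ab \<open>B \<noteq> C\<close> unfolding disjoint_def by blast
    next
      case False
      then show ?thesis
        using dis[OF ab(1,3)] P(3) ab by blast
    qed
  qed
  moreover have "\<forall>B\<in>(\<Union>a\<in>I. \<P> a). openin Y B \<and> (\<exists>y\<in>topspace Y. B \<subseteq> N y)"
    using P(1) by blast
  moreover have "\<Union>(\<Union>a\<in>I. \<P> a) = (\<Union>a\<in>I. Z a)"
  proof -
    have "\<Union>(\<Union>a\<in>I. \<P> a) = (\<Union>a\<in>I. \<Union>(\<P> a))"
      by blast
    then show ?thesis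
      using P(3) by simp
  qed
  ultimately show ?thesis
    unfolding good_def by blast
qed

text \<open>Removing from each set the union of its predecessors makes the family disjoint and keeps
  the total union, since every point survives at its first index. The hypothesis \<open>cl\<close>
  keeps the differences open.\<close>

lemma good_chain:
  assumes r: "Well_order r"
    and M: "\<And>a. a \<in> Field r \<Longrightarrow> openin Y (M a) \<and> good (M a)"
    and cl: "\<And>a. a \<in> Field r \<Longrightarrow> openin Y (topspace Y - (\<Union>b\<in>underS r a. M b))"
  shows "good (\<Union>a\<in>Field r. M a)"
proof -
  interpret wo_rel r
    using r by (simp add: wo_rel_def)
  define Z where "Z a = M a - (\<Union>b\<in>underS a. M b)" for a
  have "good (Z a)" if a: "a \<in> Field r" for a
  proof (rule good_subset)
    have "Z a = M a \<inter> (topspace Y - (\<Union>b\<in>underS a. M b))"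
      using openin_subset M[OF a] by (auto simp: Z_def)
    then show "openin Y (Z a)"
      using M[OF a] cl[OF a] by (simp add: openin_Int)
  qed (use M[OF a] in \<open>auto simp: Z_def\<close>)
  moreover have "Z a \<inter> Z b = {}" if "a \<in> Field r" "b \<in> Field r" "a \<noteq> b" for a b
  proof -
    have "a \<in> underS b \<or> b \<in> underS a"
      using TOTALS that by (auto simp: underS_def)
    moreover have "Z a \<subseteq> M a" "Z b \<subseteq> M b"
      by (auto simp: Z_def)
    ultimately show ?thesis
      by (auto simp: Z_def)
  qed
  ultimately have "good (\<Union>a\<in>Field r. Z a)"
    by (intro good_disjoint_UN) auto
  moreover have "(\<Union>a\<in>Field r. Z a) = (\<Union>a\<in>Field r. M a)"
  proof
    show "(\<Union>a\<in>Field r. M a) \<subseteq> (\<Union>a\<in>Field r. Z a)"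
    proof
      fix x assume "x \<in> (\<Union>a\<in>Field r. M a)"
      then have ne: "{a \<in> Field r. x \<in> M a} \<noteq> {}" and sub: "{a \<in> Field r. x \<in> M a} \<subseteq> Field r"
        by auto
      define m where "m = minim {a \<in> Field r. x \<in> M a}"
      have m: "m \<in> Field r" "x \<in> M m"
        using minim_in[OF sub ne] by (auto simp: m_def)
      have "x \<notin> M b" if b: "b \<in> underS m" for b
      proof
        assume "x \<in> M b"
        then have "(m, b) \<in> r"
          unfolding m_def using minim_least[OF sub] b by (auto simp: underS_def Field_def)
        then show False
          using b ANTISYM unfolding underS_def antisym_def by blast
      qed
      then show "x \<in> (\<Union>a\<in>Field r. Z a)"
        using m by (auto simp: Z_def)
    qed
  qed (auto simp: Z_def)
  ultimately show ?thesis
    by simp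
qed

end

locale mn_nabla_index = mn_nabla_space Y D G N + nabla_index Y D K lt
  for Y :: "'p topology" and D G N and K :: "'k set" and lt (infix "\<sqsubset>" 50)
begin

text \<open>The points \<open>x i\<close> with \<open>z p \<in> G (x i) (G (x i) (W i))\<close> for a fixed \<open>p\<close> form the thread: applying \<open>G\<close>
  twice gives \<open>x i \<in> G (x j) (W j)\<close> for all earlier \<open>i\<close> in it, and one such \<open>x q\<close> then plays the role of
  \<open>z p\<close> for every other choice \<open>B\<close> of neighbourhoods.\<close>

lemma no_stat_accumulation:
  assumes S: "stat S" and z: "\<And>k. k \<in> K \<Longrightarrow> z k \<in> topspace Y"
    and x: "\<And>i. i \<in> S \<Longrightarrow> x i \<in> topspace Y"
    and acc: "\<And>i W. \<lbrakk>i \<in> S; openin Y W; x i \<in> W\<rbrakk> \<Longrightarrow> \<exists>j. j \<sqsubset> i \<and> z j \<in> W"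
    and out: "\<And>i j. \<lbrakk>i \<in> S; j \<sqsubset> i\<rbrakk> \<Longrightarrow> x i \<notin> H (z j)"
    and inn: "\<And>i. i \<in> S \<Longrightarrow> \<exists>k\<in>K. x i \<in> H (z k)"
  shows False
proof -
  obtain k where k: "\<And>i. i \<in> S \<Longrightarrow> k i \<in> K" "\<And>i. i \<in> S \<Longrightarrow> x i \<in> H (z (k i))"
    using inn by metis
  obtain a where a: "a \<in> K"
    using nonempty by blast
  \<comment> \<open>Only the head of the list counts: a closed point \<open>j\<close> above
    \<open>i\<close> then lies above \<open>k i\<close>, the index of a neighbourhood containing
    \<open>x i\<close>.\<close>
  define c where "c xs = (case xs of [] \<Rightarrow> a | i # _ \<Rightarrow> if i \<in> S then k i else a)" for xs
  have "range c \<subseteq> K"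
    using a k(1) by (auto simp: c_def split: list.splits)
  define S' where "S' = {i \<in> S. closed_pt c i}"
  have S': "stat S'"
    unfolding S'_def by (rule stat_closed[OF S \<open>range c \<subseteq> K\<close>])
  define W where "W i = H (z (k i))" for i
  have W: "openin Y (W i)" "x i \<in> W i" if "i \<in> S'" for i
    using that k z by (auto simp: W_def S'_def openin_H)
  \<comment> \<open>The \<open>W i\<close> separate each term from all later ones; this excludes one
    alternative whenever \<open>G_meet\<close> is used below.\<close>
  have right: "x j \<notin> W i" if "i \<in> S'" "j \<in> S'" "i \<sqsubset> j" for i j
  proof -
    have "c [i] \<sqsubset> j"
      using that by (auto simp: S'_def closed_pt_def)
    then show ?thesis
      using that out[of j "k i"] by (simp add: c_def S'_def W_def)
  qed
  define M where "M i = G (x i) (W i)" for i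
  have M: "openin Y (M i)" "x i \<in> M i" "M i \<subseteq> W i" if "i \<in> S'" for i
    using G[OF W[OF that]] by (auto simp: M_def)
  have "\<exists>p\<in>K. stat {i \<in> S'. z p \<in> G (x i) (M i)}"
  proof (rule fodor[OF S'])
    fix i assume i: "i \<in> S'"
    show "\<exists>j. j \<sqsubset> i \<and> z j \<in> G (x i) (M i)"
      using acc[of i "G (x i) (M i)"] G[OF M(1,2)[OF i]] i by (auto simp: S'_def)
  qed
  then obtain p where T: "stat {i \<in> S'. z p \<in> G (x i) (M i)}"
    by blast
  define T where "T = {i \<in> S'. z p \<in> G (x i) (M i)}"
  have TS: "T \<subseteq> S'" and TS0: "T \<subseteq> S" and TK: "T \<subseteq> K"
    using stat_subset[OF S'] by (auto simp: T_def S'_def)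
  have chain: "x i \<in> M j" if ij: "i \<in> T" "j \<in> T" "i \<sqsubset> j" for i j
  proof -
    have "i \<in> S'" "j \<in> S'"
      using ij TS by auto
    moreover have "G (x i) (M i) \<inter> G (x j) (M j) \<noteq> {}"
      using ij by (auto simp: T_def)
    ultimately have "x i \<in> M j \<or> x j \<in> M i"
      using M by (intro G_meet) auto
    then show ?thesis
      using right M(3) \<open>i \<in> S'\<close> \<open>j \<in> S'\<close> ij(3) by blast
  qed
  show False
  proof (rule no_thread)
    show "stat T"
      using T by (simp add: T_def)
    show "x i \<in> topspace Y" if "i \<in> T" for i
      using x TS0 that by blast
    show "x i \<noteq> x j" if "i \<in> T" "j \<in> T" "i \<sqsubset> j" for i j
    proof -
      have "i \<in> S'" "j \<in> S'"
        using that TS by auto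
      then show ?thesis
        using right[of i j] W(2)[of i] that(3) by auto
    qed
    fix B assume B: "\<And>j. j \<in> T \<Longrightarrow> openin Y (B j) \<and> x j \<in> B j"
    define O' where "O' j = G (x j) (B j \<inter> W j)" for j
    have BW: "openin Y (B j \<inter> W j)" "x j \<in> B j \<inter> W j" if "j \<in> T" for j
    proof -
      have "j \<in> S'"
        using that TS by auto
      then show "openin Y (B j \<inter> W j)" "x j \<in> B j \<inter> W j"
        using B[OF that] W[of j] by (simp_all add: openin_Int)
    qed
    have O': "openin Y (O' j)" "x j \<in> O' j" "O' j \<subseteq> B j \<inter> W j" if "j \<in> T" for j
      unfolding O'_def using G[OF BW[OF that]] by auto
    \<comment> \<open>Otherwise a second pressing down gives two indices \<open>i\<close>,
      \<open>j\<close> of \<open>?T1\<close> with a common \<open>z p\<close>, and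
      \<open>G_meet\<close> puts the earlier \<open>x i\<close> into \<open>O' j\<close>.\<close>
    have "\<not> stat {j \<in> T. \<not> (\<exists>q. q \<sqsubset> j \<and> q \<in> T \<and> x q \<in> O' j)}" (is "\<not> stat ?T1")
    proof
      assume T1: "stat ?T1"
      have "\<exists>p\<in>K. stat {j \<in> ?T1. z p \<in> G (x j) (O' j)}"
      proof (rule fodor[OF T1])
        fix i assume i: "i \<in> ?T1"
        then show "\<exists>j. j \<sqsubset> i \<and> z j \<in> G (x i) (O' i)"
          using acc[of i "G (x i) (O' i)"] G[OF O'(1,2)[of i]] TS0 by auto
      qed
      then obtain p where T2: "stat {j \<in> ?T1. z p \<in> G (x j) (O' j)}"
        by blast
      obtain i where i: "i \<in> ?T1" "z p \<in> G (x i) (O' i)"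
        using stat_nonempty[OF T2] by blast
      then have "i \<in> K"
        using TK by blast
      then obtain j where j: "j \<in> ?T1" "z p \<in> G (x j) (O' j)" "i \<sqsubset> j"
        using stat_unbounded[OF T2] by blast
      have ij: "i \<in> T" "j \<in> T"
        using i(1) j(1) by auto
      have "x i \<in> O' j \<or> x j \<in> O' i"
        using i(2) j(2) O'[OF ij(1)] O'[OF ij(2)] by (intro G_meet) auto
      then show False
        using i(1) j(1,3) ij O'(3)[OF ij(1)] right[of i j] TS by blast
    qed
    then have T1: "stat {j \<in> T. \<exists>q. q \<sqsubset> j \<and> q \<in> T \<and> x q \<in> O' j}"
      using stat_split[of T "\<lambda>j. \<exists>q. q \<sqsubset> j \<and> q \<in> T \<and> x q \<in> O' j"] T by (auto simp: T_def)
    have "\<exists>q\<in>K. stat {j \<in> {j \<in> T. \<exists>q. q \<sqsubset> j \<and> q \<in> T \<and> x q \<in> O' j}. q \<in> T \<and> x q \<in> O' j}"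
      by (rule fodor[OF T1]) blast
    then obtain q where q: "stat {j \<in> {j \<in> T. \<exists>q. q \<sqsubset> j \<and> q \<in> T \<and> x q \<in> O' j}. q \<in> T \<and> x q \<in> O' j}"
      (is "stat ?S2") by blast
    have "q \<in> T"
      using stat_nonempty[OF q] by blast
    moreover have "x i \<in> B j" if ij: "j \<in> ?S2" "i \<in> T" "q \<sqsubset> i" "i \<sqsubset> j" for i j
    proof -
      have j: "j \<in> T" "x q \<in> O' j"
        using ij(1) by auto
      have "x q \<in> G (x i) (W i)"
        using chain[OF \<open>q \<in> T\<close> ij(2,3)] by (simp add: M_def)
      then have "G (x i) (W i) \<inter> G (x j) (B j \<inter> W j) \<noteq> {}"
        using j(2) unfolding O'_def by blast
      then have "x i \<in> B j \<inter> W j \<or> x j \<in> W i"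
        using W TS ij(2) BW[OF j(1)] by (intro G_meet) auto
      then show ?thesis
        using right[of i j] TS ij j by blast
    qed
    moreover have "?S2 \<subseteq> T"
      by blast
    ultimately show "\<exists>S q. stat S \<and> S \<subseteq> T \<and> q \<in> T \<and>
        (\<forall>j\<in>S. \<forall>i\<in>T. q \<sqsubset> i \<and> i \<sqsubset> j \<longrightarrow> x i \<in> B j)"
      using q by blast
  qed
qed

end

section \<open>Induction on cardinality\<close>

unbundle cardinal_syntax

text \<open>Bounds the number of values added when a small set is closed off once under an operation
  on lists.\<close>

lemma card_of_lists_ordLess:
  assumes r: "Card_order r" "stable r" "natLeq <o r" and X: "|X| <o r"
  shows "|{xs. set xs \<subseteq> X}| <o r"
proof -
  have nat: "|UNIV :: nat set| <o r"
    using card_of_nat r(3) ordIso_ordLess_trans by blast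
  have len: "|{xs. set xs \<subseteq> X \<and> length xs = n}| <o r" for n
  proof (induction n)
    case 0
    have "{xs. set xs \<subseteq> X \<and> length xs = 0} = {[]}"
      by auto
    moreover have "|{[]}| <o r"
      using card_of_singl_ordLeq[of "UNIV :: nat set" "[]"] nat ordLeq_ordLess_trans by blast
    ultimately show ?case
      by simp
  next
    case (Suc n)
    have "{xs. set xs \<subseteq> X \<and> length xs = Suc n} =
        (\<Union>x\<in>X. (#) x ` {xs. set xs \<subseteq> X \<and> length xs = n})"
      by (force simp: length_Suc_conv)
    moreover have "|(#) x ` {xs. set xs \<subseteq> X \<and> length xs = n}| <o r" for x
      using card_of_image Suc.IH ordLeq_ordLess_trans by blast
    ultimately show ?case
      by (simp only:) (rule stable_UNION[OF r(2) X])
  qed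
  have "{xs. set xs \<subseteq> X} = (\<Union>n. {xs. set xs \<subseteq> X \<and> length xs = n})"
    by auto
  then show ?thesis
    using stable_UNION[OF r(2) nat len] by simp
qed

lemma strict_order_on_underS:
  assumes r: "Well_order r" "Field r \<noteq> {}"
  shows "strict_order_on (Field r) (\<lambda>j i. j \<in> underS r i)"
proof -
  interpret wo_rel r
    using r by (simp add: wo_rel_def)
  show ?thesis
  proof
    show "x \<in> underS z" if "x \<in> underS y" "y \<in> underS z" for x y z
      using that TRANS ANTISYM unfolding underS_def trans_def antisym_def by blast
    show "x \<in> underS y \<or> x = y \<or> y \<in> underS x" if "x \<in> Field r" "y \<in> Field r" for x y
      using that TOTALS unfolding underS_def by blast
  qed (use r in \<open>auto simp: underS_def Field_def\<close>)
qed

lemma card_of_under_ordLess: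
  assumes r: "Card_order r" "infinite (Field r)" and a: "a \<in> Field r"
  shows "|under r a| <o r"
proof -
  obtain b where b: "b \<in> Field r" "a \<noteq> b" "(a, b) \<in> r"
    using infinite_Card_order_limit[OF r a] by blast
  interpret wo_rel r
    using r by (simp add: wo_rel_def card_order_on_def)
  have "under a \<subseteq> underS b"
    using b TRANS ANTISYM unfolding under_def underS_def trans_def antisym_def by blast
  then show ?thesis
    using card_of_mono1 card_of_underS[OF r(1) b(1)] ordLeq_ordLess_trans by blast
qed

text \<open>Close the empty set off \<omega> times. Regularity and uncountability keep the result a
  proper initial segment, hence the set of predecessors of a closed point.\<close>

lemma stat_Field_regular:
  assumes r: "Card_order r" "regularCard r" "natLeq <o r"
  shows "strict_order_on.stat (Field r) (\<lambda>j i. j \<in> underS r i) (Field r)"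
proof -
  have wo: "Well_order r"
    using r(1) by (simp add: card_order_on_def)
  interpret wo_rel r
    using wo by (simp add: wo_rel_def)
  have inf: "infinite (Field r)"
  proof
    assume "finite (Field r)"
    then have "|Field r| <o natLeq"
      by (simp add: finite_iff_ordLess_natLeq)
    then have "r <o natLeq"
      using card_of_Field_ordIso[OF r(1)] ordIso_ordLess_trans ordIso_symmetric by blast
    then show False
      using r(3) ordLess_transitive ordLess_irreflexive by blast
  qed
  then have ne: "Field r \<noteq> {}"
    by auto
  interpret I: strict_order_on "Field r" "\<lambda>j i. j \<in> underS i"
    by (rule strict_order_on_underS[OF wo ne])
  have st: "stable r"
    by (rule regularCard_stable[OF r(1) inf r(2)])
  have nat: "|UNIV :: nat set| <o r"
    using card_of_nat r(3) ordIso_ordLess_trans by blast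
  show ?thesis
    unfolding I.stat_def
  proof (intro conjI allI impI)
    fix c :: "'a list \<Rightarrow> 'a" assume c: "range c \<subseteq> Field r"
    \<comment> \<open>Adding \<open>under (c xs)\<close> rather than the mere value keeps every
      stage an initial segment.\<close>
    define F where "F A = A \<union> (\<Union>xs\<in>{xs. set xs \<subseteq> A}. under (c xs))" for A
    define A where "A n = (F ^^ n) {}" for n
    have A: "|A n| <o r \<and> ofilter (A n)" for n
    proof (induction n)
      case 0
      have "|{} :: 'a set| <o r"
        using card_of_empty[of "UNIV :: nat set"] nat ordLeq_ordLess_trans by blast
      then show ?case
        by (simp add: A_def ofilter_def)
    next
      case (Suc n)
      have "|\<Union>xs\<in>{xs. set xs \<subseteq> A n}. under (c xs)| <o r"
        using Suc.IH c
        by (intro stable_UNION[OF st card_of_lists_ordLess[OF r(1) st r(3)]]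
            card_of_under_ordLess[OF r(1) inf]) auto
      then have "|F (A n)| <o r"
        unfolding F_def using Suc.IH
        by (intro card_of_Un_ordLess_infinite_Field[OF inf r(1)]) auto
      moreover have "ofilter (F (A n))"
      proof -
        have "ofilter (\<Union>xs\<in>{xs. set xs \<subseteq> A n}. under (c xs))"
          by (intro ofilter_UNION under_ofilter)
        then show ?thesis
          using Suc.IH unfolding F_def ofilter_def by blast
      qed
      ultimately show ?case
        by (simp add: A_def)
    qed
    have mono: "A m \<subseteq> A n" if "m \<le> n" for m n
      using that by (induction rule: dec_induct) (auto simp: A_def F_def)
    have "|\<Union>n. A n| <o r"
      using A by (intro stable_UNION[OF st nat]) auto
    then have "(\<Union>n. A n) \<noteq> Field r"
      using card_of_Field_ordIso[OF r(1)] not_ordLess_ordIso[of "|Field r|" r] by auto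
    moreover have "ofilter (\<Union>n. A n)"
      using A by (intro ofilter_UNION) auto
    ultimately obtain i where i: "i \<in> Field r" "(\<Union>n. A n) = underS i"
      by (metis ofilter_underS_Field)
    have "c xs \<in> underS i" if xs: "\<forall>x\<in>set xs. x \<in> underS i" for xs
    proof -
      have "\<exists>n. set xs \<subseteq> A n"
        using xs
      proof (induction xs)
        case (Cons x xs)
        then obtain n where n: "set xs \<subseteq> A n"
          by auto
        have "x \<in> (\<Union>n. A n)"
          unfolding i(2) using Cons.prems by simp
        then obtain m where "x \<in> A m"
          by blast
        then have "set (x # xs) \<subseteq> A (max m n)"
          using mono[of m "max m n"] mono[of n "max m n"] n by auto
        then show ?case ..
      qed simp
      then obtain n where "set xs \<subseteq> A n" ..
      moreover have "c xs \<in> under (c xs)"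
        using c REFL unfolding under_def refl_on_def by auto
      ultimately have "c xs \<in> A (Suc n)"
        by (auto simp: A_def F_def)
      then show ?thesis
        using i(2) by blast
    qed
    then show "\<exists>i\<in>Field r. I.closed_pt c i"
      using i(1) unfolding I.closed_pt_def by blast
  qed simp
qed

section \<open>Hulls with closed neighbourhood union\<close>

context mn_nabla_space
begin

lemma mn_nabla_index_underS:
  assumes "Well_order r" "Field r \<noteq> {}"
  shows "mn_nabla_index Y D G N (Field r) (\<lambda>j i. j \<in> underS r i)"
  by (intro mn_nabla_index.intro mn_nabla_space_axioms nabla_index.intro
      strict_order_on_underS[OF assms] nabla_space_axioms)

text \<open>Otherwise every candidate \<open>J\<close> has an accumulation point outside
  \<open>V J\<close>. Adding these one at a time along the successor cardinal of |X| gives a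
  sequence forbidden by \<open>no_stat_accumulation\<close>.\<close>

lemma closed_hull:
  assumes X: "X \<subseteq> topspace Y" "infinite X"
  shows "\<exists>J. X \<subseteq> J \<and> J \<subseteq> topspace Y \<and> |J| \<le>o |X| \<and> V_closed J"
proof (rule ccontr)
  assume n: "\<not> ?thesis"
  define r where "r = cardSuc |X|"
  have r: "Card_order r"
    unfolding r_def by (rule cardSuc_Card_order[OF card_of_Card_order])
  have reg: "regularCard r"
    unfolding r_def
    by (rule infinite_cardSuc_regularCard[OF _ card_of_Card_order]) (simp add: Field_card_of X(2))
  have "natLeq \<le>o |X|"
    using X(2) infinite_iff_natLeq_ordLeq by blast
  then have nat: "natLeq <o r"
    unfolding r_def using cardSuc_greater card_of_Card_order ordLeq_ordLess_trans by blast
  have wo: "Well_order r"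
    using r by (simp add: card_order_on_def)
  interpret W: wo_rel r
    using wo by (simp add: wo_rel_def)
  have ne: "Field r \<noteq> {}"
    unfolding r_def by (rule Field_cardSuc_not_empty[OF card_of_Card_order])
  interpret I: mn_nabla_index Y D G N "Field r" "\<lambda>j i. j \<in> underS r i"
    by (rule mn_nabla_index_underS[OF wo ne])
  \<comment> \<open>Until \<open>X\<close> is exhausted its remaining points are listed; only then
    are accumulation points added.\<close>
  define \<phi> where "\<phi> J = (if X \<subseteq> J
      then SOME x. x \<in> topspace Y - V J \<and> (\<forall>W. openin Y W \<and> x \<in> W \<longrightarrow> (\<exists>y\<in>J. y \<in> W))
      else SOME x. x \<in> X - J)" for J
  have \<phi>1: "\<phi> J \<in> topspace Y - V J \<and> (\<forall>W. openin Y W \<and> \<phi> J \<in> W \<longrightarrow> (\<exists>y\<in>J. y \<in> W))"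
    if J: "X \<subseteq> J" "J \<subseteq> topspace Y" "|J| \<le>o |X|" for J
  proof -
    have "\<not> V_closed J"
      using n J by blast
    from not_V_closedD[OF J(2) this]
    have "\<exists>x. x \<in> topspace Y - V J \<and> (\<forall>W. openin Y W \<and> x \<in> W \<longrightarrow> (\<exists>y\<in>J. y \<in> W))"
      by (simp only: Bex_def)
    from someI_ex[OF this] show ?thesis
      unfolding \<phi>_def using J(1) by simp
  qed
  have \<phi>2: "\<phi> J \<in> X - J" if "\<not> X \<subseteq> J" for J
  proof -
    have "\<exists>x. x \<in> X - J"
      using that by blast
    from someI_ex[OF this] show ?thesis
      unfolding \<phi>_def using that by simp
  qed
  define z where "z = W.worec (\<lambda>z i. \<phi> (z ` underS r i))"
  have z: "z i = \<phi> (z ` underS r i)" for i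
  proof -
    have "W.adm_wo (\<lambda>z i. \<phi> (z ` underS r i))"
      unfolding W.adm_wo_def by (metis image_cong)
    from W.worec_fixpoint[OF this] show ?thesis
      unfolding z_def by (rule fun_cong)
  qed
  have card: "|z ` underS r i| \<le>o |X|" if "i \<in> Field r" for i
  proof -
    have "|underS r i| <o r"
      by (rule card_of_underS[OF r that])
    then have "|underS r i| \<le>o |X|"
      unfolding r_def using cardSuc_ordLeq_ordLess[OF card_of_Card_order card_of_Card_order] by blast
    then show ?thesis
      using card_of_image ordLeq_transitive by blast
  qed
  have top: "i \<in> Field r \<longrightarrow> z i \<in> topspace Y" for i
  proof (induction i rule: W.well_order_induct)
    case (1 i)
    show ?case
    proof
      assume i: "i \<in> Field r"
      have "z ` underS r i \<subseteq> topspace Y"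
        using 1 by (auto simp: underS_def Field_def)
      then show "z i \<in> topspace Y"
      proof (cases "X \<subseteq> z ` underS r i")
        case True
        then show ?thesis
          unfolding z[of i] using \<phi>1[OF _ \<open>z ` underS r i \<subseteq> topspace Y\<close> card[OF i]] by blast
      next
        case False
        then show ?thesis
          unfolding z[of i] using \<phi>2 X(1) by blast
      qed
    qed
  qed
  have sub: "z ` underS r i \<subseteq> topspace Y" for i
    using top I.lt_in by blast
  obtain a where a: "a \<in> Field r" "X \<subseteq> z ` underS r a"
  proof -
    have "\<exists>a\<in>Field r. X \<subseteq> z ` underS r a"
    proof (rule ccontr)
      assume "\<not> ?thesis"
      then have new: "z i \<in> X - z ` underS r i" if "i \<in> Field r" for i
        using \<phi>2[of "z ` underS r i"] z[of i] that by auto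
      have "inj_on z (Field r)"
      proof (rule inj_onI)
        fix i j assume ij: "i \<in> Field r" "j \<in> Field r" "z i = z j"
        have "i \<notin> underS r j"
          using new[OF ij(2)] unfolding ij(3)[symmetric] by blast
        moreover have "j \<notin> underS r i"
          using new[OF ij(1)] unfolding ij(3) by blast
        ultimately show "i = j"
          using I.lt_total[OF ij(1,2)] by blast
      qed
      moreover have "z ` Field r \<subseteq> X"
        using new by auto
      ultimately have "|Field r| \<le>o |X|"
        using card_of_ordLeq[of "Field r" X] by blast
      then have "r \<le>o |X|"
        using card_of_Field_ordIso[OF r] ordIso_symmetric ordIso_ordLeq_trans by blast
      moreover have "|X| <o r"
        unfolding r_def by (rule cardSuc_greater[OF card_of_Card_order])
      ultimately show False
        using not_ordLess_ordLeq by blast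
    qed
    then show thesis
      using that by blast
  qed
  define S where "S = {i \<in> Field r. a \<in> underS r i}"
  have S: "I.stat S"
    unfolding S_def by (rule I.stat_above[OF stat_Field_regular[OF r reg nat] a(1)])
  have zS: "z i \<in> topspace Y - V (z ` underS r i)"
    "\<forall>W. openin Y W \<and> z i \<in> W \<longrightarrow> (\<exists>y\<in>z ` underS r i. y \<in> W)" if i: "i \<in> S" for i
  proof -
    have "underS r a \<subseteq> underS r i"
      using i I.lt_trans by (auto simp: S_def)
    then have "X \<subseteq> z ` underS r i"
      using a(2) by blast
    moreover have "i \<in> Field r"
      using i by (simp add: S_def)
    ultimately have "z i \<in> topspace Y - V (z ` underS r i) \<and>
        (\<forall>W. openin Y W \<and> z i \<in> W \<longrightarrow> (\<exists>y\<in>z ` underS r i. y \<in> W))"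
      unfolding z[of i] by (intro \<phi>1 sub card)
    then show "z i \<in> topspace Y - V (z ` underS r i)"
      "\<forall>W. openin Y W \<and> z i \<in> W \<longrightarrow> (\<exists>y\<in>z ` underS r i. y \<in> W)"
      by blast+
  qed
  \<comment> \<open>The accumulation points are terms of the sequence itself, so the hypothesis
    \<open>inn\<close> holds by \<open>z i \<in> H (z i)\<close>.\<close>
  show False
  proof (rule I.no_stat_accumulation[OF S, of z z])
    show "z k \<in> topspace Y" if "k \<in> Field r" for k
      using top that by blast
    show "z i \<in> topspace Y" if "i \<in> S" for i
      using zS(1)[OF that] by blast
    show "\<exists>j. j \<in> underS r i \<and> z j \<in> W" if "i \<in> S" "openin Y W" "z i \<in> W" for i W
      using zS(2)[OF that(1)] that(2,3) by blast
    show "z i \<notin> H (z j)" if "i \<in> S" "j \<in> underS r i" for i j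
      using zS(1)[OF that(1)] that(2) by (auto simp: V_def)
    show "\<exists>k\<in>Field r. z i \<in> H (z k)" if "i \<in> S" for i
      using zS(1)[OF that] mem_H[of "z i"] that by (auto simp: S_def)
  qed
qed

section \<open>The countable, regular and singular cases\<close>

lemma good_V_countable:
  assumes X: "X \<subseteq> topspace Y" "countable X"
  shows "good (V X)"
proof -
  have "good (\<Union>a\<in>Field |X|. H a)"
  proof (rule good_chain)
    show "openin Y (H a) \<and> good (H a)" if "a \<in> Field |X|" for a
      using that X(1) by (auto simp: Field_card_of intro: openin_H good_H)
    fix a
    have "underS |X| a \<subseteq> X"
      using Field_card_of[of X] by (auto simp: underS_def Field_def)
    then have "V_closed (underS |X| a)"
      using X countable_subset by (intro V_closed_countable) auto
    then show "openin Y (topspace Y - (\<Union>b\<in>underS |X| a. H b))"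
      by (simp add: V_closed_def V_def)
  qed (rule card_of_Well_order)
  then show ?thesis
    by (simp add: Field_card_of V_def)
qed

text \<open>In a hull \<open>J\<close>, well-ordered in type |J|, the indices whose initial segment
  has a non-closed union are nonstationary. So the closed points of some operation \<open>c\<close>
  give a chain of smaller sets with closed union, to which the induction hypothesis applies.\<close>

lemma good_V_regular:
  assumes X: "X \<subseteq> topspace Y" "uncountable X" and reg: "regularCard |X|"
    and IH: "\<And>Z. Z \<subseteq> topspace Y \<Longrightarrow> |Z| <o |X| \<Longrightarrow> good (V Z)"
  shows "good (V X)"
proof -
  have inf: "infinite X"
    using X(2) countable_finite by blast
  obtain J where J: "X \<subseteq> J" "J \<subseteq> topspace Y" "|J| \<le>o |X|" "V_closed J"
    using closed_hull[OF X(1) inf] by blast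
  have iso: "|X| =o |J|"
    using J(3) card_of_mono1[OF J(1)] by (simp add: ordIso_iff_ordLeq)
  define r where "r = |J|"
  have F: "Field r = J"
    by (simp add: r_def Field_card_of)
  have r: "Card_order r" "Well_order r"
    unfolding r_def by (rule card_of_Card_order card_of_Well_order)+
  have reg': "regularCard r"
    unfolding r_def by (rule regularCard_ordIso[OF iso _ reg])
      (simp add: cinfinite_def Field_card_of card_of_card_order_on inf)
  have "\<not> |J| \<le>o natLeq"
    using X(2) countable_subset[OF J(1)] countable_card_le_natLeq[of J] by auto
  then have nat: "natLeq <o r"
    unfolding r_def using not_ordLeq_iff_ordLess[OF natLeq_Well_order card_of_Well_order] by auto
  have ne: "Field r \<noteq> {}"
    using F J(1) inf by auto
  interpret W: wo_rel r
    using r by (simp add: wo_rel_def)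
  interpret I: mn_nabla_index Y D G N "Field r" "\<lambda>j i. j \<in> underS r i"
    by (rule mn_nabla_index_underS[OF r(2) ne])
  have uJ: "underS r i \<subseteq> J" for i
    using I.lt_in F by blast
  have JV: "J \<subseteq> V J"
    using J(2) mem_H by (auto simp: V_def)
  define S where "S = {i \<in> J. \<not> V_closed (underS r i)}"
  have "\<not> I.stat S"
  proof
    assume S: "I.stat S"
    have "\<forall>i\<in>S. \<exists>x\<in>topspace Y - V (underS r i).
        \<forall>W. openin Y W \<and> x \<in> W \<longrightarrow> (\<exists>y\<in>underS r i. y \<in> W)"
      using uJ J(2) by (intro ballI not_V_closedD) (auto simp: S_def)
    from bchoice[OF this[unfolded Bex_def[of "topspace Y - V _"]]]
    obtain x where x: "\<And>i. i \<in> S \<Longrightarrow> x i \<in> topspace Y - V (underS r i)"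
      "\<And>i. i \<in> S \<Longrightarrow> \<forall>W. openin Y W \<and> x i \<in> W \<longrightarrow> (\<exists>y\<in>underS r i. y \<in> W)"
      by auto
    show False
    proof (rule I.no_stat_accumulation[OF S, of id x])
      show "id k \<in> topspace Y" if "k \<in> Field r" for k
        using that F J(2) by auto
      show "x i \<in> topspace Y" if "i \<in> S" for i
        using x(1)[OF that] by blast
      show "\<exists>j. j \<in> underS r i \<and> id j \<in> W" if "i \<in> S" "openin Y W" "x i \<in> W" for i W
        using x(2)[OF that(1)] that(2,3) by auto
      show "x i \<notin> H (id j)" if "i \<in> S" "j \<in> underS r i" for i j
        using x(1)[OF that(1)] that(2) by (auto simp: V_def)
      \<comment> \<open>This is what the hull is for: \<open>x i\<close> is a closure point of
        \<open>J\<close>, and \<open>V J\<close> is a closed set containing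
        \<open>J\<close>.\<close>
      show "\<exists>k\<in>Field r. x i \<in> H (id k)" if i: "i \<in> S" for i
      proof (rule ccontr)
        assume "\<not> ?thesis"
        then have "x i \<in> topspace Y - V J"
          using x(1)[OF i] F by (auto simp: V_def)
        then show False
          using x(2)[OF i, rule_format, of "topspace Y - V J"] J(4) uJ JV
          unfolding V_closed_def by auto
      qed
    qed
  qed
  then obtain c where c: "range c \<subseteq> Field r" "\<And>i. i \<in> S \<Longrightarrow> \<not> I.closed_pt c i"
    unfolding I.stat_def using F by (auto simp: S_def)
  have E: "V_closed (underS r i)" if "i \<in> Field r" "I.closed_pt c i" for i
    using c(2)[of i] that F by (auto simp: S_def)
  have "\<forall>a\<in>Field r. \<exists>i. i \<in> Field r \<and> I.closed_pt c i \<and> a \<in> underS r i"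
  proof
    fix a assume a: "a \<in> Field r"
    show "\<exists>i. i \<in> Field r \<and> I.closed_pt c i \<and> a \<in> underS r i"
      using I.stat_unbounded[OF I.stat_closed[OF stat_Field_regular[OF r(1) reg' nat] c(1)] a] by blast
  qed
  from bchoice[OF this] obtain b where b: "\<And>a. a \<in> Field r \<Longrightarrow> b a \<in> Field r"
    "\<And>a. a \<in> Field r \<Longrightarrow> I.closed_pt c (b a)" "\<And>a. a \<in> Field r \<Longrightarrow> a \<in> underS r (b a)"
    by auto
  have "good (\<Union>a\<in>Field r. V (underS r (b a)))"
  proof (rule good_chain[OF r(2)])
    fix a assume a: "a \<in> Field r"
    have "|underS r (b a)| <o |X|"
      using card_of_underS[OF r(1) b(1)[OF a]] iso unfolding r_def
      by (metis ordIso_symmetric ordLess_ordIso_trans)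
    then show "openin Y (V (underS r (b a))) \<and> good (V (underS r (b a)))"
      using uJ J(2) by (intro conjI openin_V IH) auto
    \<comment> \<open>A union of segments below closed points is empty, everything, or the segment
      below another closed point; in each case its \<open>V\<close> is closed.\<close>
    define B where "B = (\<Union>a'\<in>underS r a. underS r (b a'))"
    have "V_closed B"
    proof (cases "underS r a = {}")
      case True
      then show ?thesis
        by (intro V_closed_countable) (auto simp: B_def)
    next
      case False
      \<comment> \<open>Lists are finite and the segments linearly ordered by inclusion; the empty
        list is where \<open>underS r a\<close> has to be nonempty.\<close>
      have list: "\<exists>a'\<in>underS r a. set xs \<subseteq> underS r (b a')" if "set xs \<subseteq> B" for xs
        using that
      proof (induction xs)
        case Nil
        then show ?case
          using False by auto
      next
        case (Cons y ys)
        then obtain u v where u: "u \<in> underS r a" "set ys \<subseteq> underS r (b u)"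
          and v: "v \<in> underS r a" "y \<in> underS r (b v)"
          by (auto simp: B_def)
        consider "underS r (b u) \<subseteq> underS r (b v)" | "underS r (b v) \<subseteq> underS r (b u)"
          using W.ofilter_linord[OF W.underS_ofilter W.underS_ofilter] by blast
        then show ?case
          using u v by cases auto
      qed
      have "W.ofilter B"
        unfolding B_def by (intro W.ofilter_UNION W.underS_ofilter)
      then consider "B = Field r" | s where "s \<in> Field r" "B = underS r s"
        using W.ofilter_underS_Field by blast
      then show ?thesis
      proof cases
        case 1
        then show ?thesis
          using J(4) F by simp
      next
        case 2
        have "I.closed_pt c s"
          unfolding I.closed_pt_def
        proof (intro allI impI)
          fix xs assume "\<forall>x\<in>set xs. x \<in> underS r s"
          then obtain a' where a': "a' \<in> underS r a" "set xs \<subseteq> underS r (b a')"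
            using list[of xs] 2 by blast
          then have "c xs \<in> underS r (b a')"
            using b(2)[of a'] I.lt_in unfolding I.closed_pt_def by blast
          then show "c xs \<in> underS r s"
            using a' 2 by (auto simp: B_def)
        qed
        then show ?thesis
          using E 2 by simp
      qed
    qed
    moreover have "(\<Union>a'\<in>underS r a. V (underS r (b a'))) = V B"
      by (auto simp: V_def B_def)
    ultimately show "openin Y (topspace Y - (\<Union>a'\<in>underS r a. V (underS r (b a'))))"
      by (simp add: V_closed_def)
  qed
  then show ?thesis
  proof (rule good_subset)
    show "openin Y (V X)"
      by (rule openin_V[OF X(1)])
    show "V X \<subseteq> (\<Union>a\<in>Field r. V (underS r (b a)))"
      using J(1) F b(3) unfolding V_def by blast
  qed
qed

text \<open>A continuous chain \<open>L a\<close> of small sets with closed union, indexed by a small cofinal set \<open>C\<close>. Each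
  \<open>J n b\<close> is enumerated by \<open>Q b\<close>, and \<open>J (Suc n) a\<close> contains the parts of all the \<open>J n b\<close> enumerated by \<open>Q a\<close>.
  As \<open>Q\<close> is continuous in \<open>a\<close>, so is \<open>L\<close>. The countable set \<open>range f\<close> only makes \<open>C\<close> infinite.\<close>

lemma good_V_singular:
  assumes X: "X \<subseteq> topspace Y" "uncountable X" and sing: "\<not> regularCard |X|"
    and IH: "\<And>Z. Z \<subseteq> topspace Y \<Longrightarrow> |Z| <o |X| \<Longrightarrow> good (V Z)"
  shows "good (V X)"
proof -
  have inf: "infinite X"
    using X(2) countable_finite by blast
  define r where "r = |X|"
  have F: "Field r = X"
    by (simp add: r_def Field_card_of)
  have r: "Card_order r" "Well_order r"
    unfolding r_def by (rule card_of_Card_order card_of_Well_order)+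
  interpret W: wo_rel r
    using r by (simp add: wo_rel_def)
  obtain C0 where C0: "C0 \<subseteq> X" "cofinal C0 r" "\<not> |C0| =o |X|"
    using sing F unfolding regularCard_def r_def by blast
  obtain f :: "nat \<Rightarrow> 'p" where f: "inj f" "range f \<subseteq> X"
    using infinite_countable_subset[OF inf] by blast
  define C where "C = C0 \<union> range f"
  have CX: "C \<subseteq> X" and Cinf: "infinite C"
    using C0(1) f range_inj_infinite[OF f(1)] by (auto simp: C_def)
  have Ccard: "|C| <o |X|"
    unfolding C_def
  proof (rule card_of_Un_ordLess_infinite[OF inf])
    show "|C0| <o |X|"
      using card_of_mono1[OF C0(1)] C0(3) by (simp add: ordLeq_iff_ordLess_or_ordIso)
    have "\<not> |X| \<le>o |range f|"
    proof
      assume "|X| \<le>o |range f|"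
      moreover have "|range f| \<le>o natLeq"
        using countable_card_le_natLeq[of "range f"] by simp
      ultimately have "|X| \<le>o natLeq"
        using ordLeq_transitive by blast
      then show False
        using X(2) countable_card_le_natLeq[of X] by simp
    qed
    then show "|range f| <o |X|"
      using not_ordLeq_iff_ordLess[OF card_of_Well_order card_of_Well_order] by blast
  qed
  have cof: "\<exists>b\<in>C. a \<in> underS r b" if "a \<in> X" for a
    using C0(2) that F unfolding cofinal_def C_def underS_def by blast
  have tr: "a \<in> underS r c" if "(a, b) \<in> r" "b \<in> underS r c" for a b c
    using that W.TRANS W.ANTISYM unfolding underS_def trans_def antisym_def by blast
  \<comment> \<open>Only points below an element of \<open>C\<close> preceding \<open>a\<close>
    enter, not all predecessors of \<open>a\<close>: \<open>C\<close> need not be closed, and this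
    makes \<open>Q\<close> continuous where \<open>C\<close> has no last element before
    \<open>a\<close>. Adding \<open>C\<close> gives \<open>CQ\<close>, so unions over
    \<open>C\<close> keep the size of \<open>Q a\<close>.\<close>
  define Q where "Q a = {g. \<exists>b\<in>C. b \<in> underS r a \<and> (g, b) \<in> r} \<union> C" for a
  have QX: "Q a \<subseteq> X" for a
    using CX F unfolding Q_def Field_def by blast
  have Qinf: "infinite (Q a)" for a
    using Cinf by (auto simp: Q_def)
  have Qcard: "|Q a| <o |X|" if "a \<in> C" for a
    unfolding Q_def
  proof (rule card_of_Un_ordLess_infinite[OF inf _ Ccard])
    have "{g. \<exists>b\<in>C. b \<in> underS r a \<and> (g, b) \<in> r} \<subseteq> underS r a"
      using tr by blast
    moreover have "|underS r a| <o |X|"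
      using card_of_underS[OF r(1)] that CX F unfolding r_def by blast
    ultimately show "|{g. \<exists>b\<in>C. b \<in> underS r a \<and> (g, b) \<in> r}| <o |X|"
      using card_of_mono1 ordLeq_ordLess_trans by blast
  qed
  have CQ: "|C| \<le>o |Q a|" for a
    by (rule card_of_mono1) (simp add: Q_def)
  have "\<forall>Z. \<exists>J. Z \<subseteq> topspace Y \<and> infinite Z \<longrightarrow>
      Z \<subseteq> J \<and> J \<subseteq> topspace Y \<and> |J| \<le>o |Z| \<and> V_closed J"
    using closed_hull by simp
  from choice[OF this] obtain h where "\<forall>Z. Z \<subseteq> topspace Y \<and> infinite Z \<longrightarrow>
      Z \<subseteq> h Z \<and> h Z \<subseteq> topspace Y \<and> |h Z| \<le>o |Z| \<and> V_closed (h Z)" ..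
  then have h: "Z \<subseteq> h Z" "h Z \<subseteq> topspace Y" "|h Z| \<le>o |Z|" "V_closed (h Z)"
    if "Z \<subseteq> topspace Y" "infinite Z" for Z
    using that by simp_all
  define enum :: "'p set \<Rightarrow> 'p set \<Rightarrow> 'p \<Rightarrow> 'p" where "enum A B = (SOME g. g ` B = A)" for A B
  have enum: "enum A B ` B = A" if "|A| \<le>o |B|" "infinite A" for A B
  proof -
    have "A \<noteq> {}"
      using that(2) by auto
    then have "\<exists>g. g ` B = A"
      using card_of_ordLeq2[of A B] that(1) by blast
    then show ?thesis
      unfolding enum_def by (rule someI_ex)
  qed
  define step where "step Jn a = Jn a \<union> (\<Union>b\<in>C. enum (Jn b) (Q b) ` (Q a \<inter> Q b))" for Jn a
  define J where "J = rec_nat Q (\<lambda>_ Jn a. h (step Jn a))"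
  have J0: "J 0 = Q" and JSuc: "J (Suc n) a = h (step (J n) a)" for n a
    by (simp_all add: J_def)
  have step: "step Jn a \<subseteq> topspace Y" "infinite (step Jn a)" "|step Jn a| \<le>o |Q a|"
    if Jn: "\<forall>a\<in>C. Jn a \<subseteq> topspace Y \<and> infinite (Jn a) \<and> |Jn a| \<le>o |Q a|" and a: "a \<in> C" for Jn a
  proof -
    have en: "enum (Jn b) (Q b) ` Q b = Jn b" if "b \<in> C" for b
      using Jn that by (intro enum) auto
    have "enum (Jn b) (Q b) ` (Q a \<inter> Q b) \<subseteq> topspace Y" if "b \<in> C" for b
      using en[OF that] Jn that by blast
    then show "step Jn a \<subseteq> topspace Y"
      using Jn a unfolding step_def by blast
    show "infinite (step Jn a)"
      using Jn a by (auto simp: step_def)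
    show "|step Jn a| \<le>o |Q a|"
      unfolding step_def
    proof (rule card_of_Un_ordLeq_infinite_Field)
      show "infinite (Field |Q a| )"
        using Qinf by (simp add: Field_card_of)
      show "|Jn a| \<le>o |Q a|"
        using Jn a by blast
      have "|enum (Jn b) (Q b) ` (Q a \<inter> Q b)| \<le>o |Q a|" for b
        using card_of_image card_of_mono1[of "Q a \<inter> Q b" "Q a"] ordLeq_transitive by blast
      then show "|\<Union>b\<in>C. enum (Jn b) (Q b) ` (Q a \<inter> Q b)| \<le>o |Q a|"
        by (intro card_of_UNION_ordLeq_infinite[OF Qinf CQ] ballI)
    qed (rule card_of_Card_order)
  qed
  have J: "\<forall>a\<in>C. J n a \<subseteq> topspace Y \<and> infinite (J n a) \<and> |J n a| \<le>o |Q a|" for n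
  proof (induction n)
    case 0
    then show ?case
      using QX X(1) Qinf ordIso_imp_ordLeq[OF card_of_refl] by (auto simp: J0)
  next
    case (Suc n)
    show ?case
    proof (intro ballI conjI)
      fix a assume a: "a \<in> C"
      note st = step[OF Suc.IH a]
      show "J (Suc n) a \<subseteq> topspace Y"
        unfolding JSuc by (rule h(2)[OF st(1,2)])
      show "infinite (J (Suc n) a)"
        unfolding JSuc using h(1)[OF st(1,2)] st(2) finite_subset by blast
      show "|J (Suc n) a| \<le>o |Q a|"
        unfolding JSuc using h(3)[OF st(1,2)] st(3) by (rule ordLeq_transitive)
    qed
  qed
  have stepJ: "step (J n) a \<subseteq> J (Suc n) a" and clsJ: "V_closed (J (Suc n) a)" if a: "a \<in> C" for n a
    unfolding JSuc using h(1,4)[OF step(1,2)[OF J a]] by blast+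
  define L where "L a = (\<Union>n. J n a)" for a
  \<comment> \<open>The code \<open>g\<close> of \<open>y\<close> is chosen independently of
    \<open>a\<close>, so inclusions among the sets \<open>Q a\<close> carry over to the
    \<open>L a\<close>. Monotonicity and continuity of \<open>L\<close> both come from this.\<close>
  have move: "\<exists>g\<in>Q b. \<forall>a\<in>C. g \<in> Q a \<longrightarrow> y \<in> L a" if b: "b \<in> C" and y: "y \<in> L b" for b y
  proof -
    obtain n where n: "y \<in> J n b"
      using y by (auto simp: L_def)
    have "enum (J n b) (Q b) ` Q b = J n b"
      using J b by (intro enum) auto
    then obtain g where g: "g \<in> Q b" "y = enum (J n b) (Q b) g"
      using n by blast
    have "y \<in> L a" if "a \<in> C" "g \<in> Q a" for a
    proof -
      have "y \<in> step (J n) a"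
        using that g b unfolding step_def by blast
      then show ?thesis
        using stepJ[OF that(1)] unfolding L_def by blast
    qed
    then show ?thesis
      using g(1) by blast
  qed
  have Ltop: "L a \<subseteq> topspace Y" if "a \<in> C" for a
    using J that unfolding L_def by blast
  have Lcls: "V_closed (L a)" if a: "a \<in> C" for a
  proof -
    \<comment> \<open>The initial \<open>J 0 a\<close> need not have a closed union; it is absorbed
      by the later stages, which are hulls.\<close>
    have "J n a \<subseteq> J (Suc n) a" for n
      using stepJ[OF a, of n] unfolding step_def by blast
    then have "L a = (\<Union>n. J (Suc n) a)"
      unfolding L_def by blast
    then show ?thesis
      using V_closed_UN_seq[of "\<lambda>n. J (Suc n) a"] clsJ[OF a] by simp
  qed
  have Lcard: "|L a| <o |X|" if a: "a \<in> C" for a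
  proof -
    have "|UNIV :: nat set| \<le>o |Q a|"
      using Qinf infinite_iff_card_of_nat by blast
    then have "|L a| \<le>o |Q a|"
      unfolding L_def using J a by (intro card_of_UNION_ordLeq_infinite[OF Qinf]) auto
    then show ?thesis
      using Qcard[OF a] ordLeq_ordLess_trans by blast
  qed
  have Lmono: "L b \<subseteq> L a" if "a \<in> C" "b \<in> C" "(b, a) \<in> r" for a b
  proof -
    have "c \<in> underS r a" if "c \<in> underS r b" for c
      using that \<open>(b, a) \<in> r\<close> transD[OF W.TRANS, of c b a] antisymD[OF W.ANTISYM, of a b]
      by (auto simp: underS_def)
    then have "Q b \<subseteq> Q a"
      by (auto simp: Q_def)
    then show ?thesis
      using move[OF that(2)] that(1) by blast
  qed
  have Fr: "Field (Restr r C) = C"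
    using CX F W.REFL by (intro Refl_Field_Restr2) auto
  have "good (\<Union>a\<in>Field (Restr r C). V (L a))"
  proof (rule good_chain)
    show "Well_order (Restr r C)"
      by (rule Well_order_Restr[OF r(2)])
    fix a assume "a \<in> Field (Restr r C)"
    then have a: "a \<in> C"
      by (simp add: Fr)
    show "openin Y (V (L a)) \<and> good (V (L a))"
      using Ltop[OF a] Lcard[OF a] by (intro conjI openin_V IH)
    define P where "P = underS r a \<inter> C"
    have P: "underS (Restr r C) a = P"
      using a by (auto simp: underS_def P_def)
    have "V_closed (\<Union>b\<in>P. L b)"
    proof (cases "\<exists>b\<in>P. \<forall>b'\<in>P. (b', b) \<in> r")
      case True
      then obtain b where b: "b \<in> P" "\<forall>b'\<in>P. (b', b) \<in> r"
        by blast
      then have "(\<Union>b\<in>P. L b) = L b"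
        using Lmono unfolding P_def by blast
      then show ?thesis
        using Lcls b(1) by (simp add: P_def)
    next
      case False
      show ?thesis
      proof (cases "P = {}")
        case True
        then show ?thesis
          by (simp add: V_closed_countable)
      next
        case ne: False
        have "L a \<subseteq> (\<Union>b\<in>P. L b)"
        proof
          fix y assume "y \<in> L a"
          then obtain g where g: "g \<in> Q a" "\<And>b. b \<in> C \<Longrightarrow> g \<in> Q b \<Longrightarrow> y \<in> L b"
            using move[OF a] by blast
          have "\<exists>b\<in>P. g \<in> Q b"
          proof (cases "g \<in> C")
            case True
            then show ?thesis
              using ne by (auto simp: Q_def)
          next
            case gC: False
            then obtain b' where b': "b' \<in> P" "(g, b') \<in> r"
              using g(1) unfolding Q_def P_def by blast
            then obtain b where b: "b \<in> P" "(b, b') \<notin> r"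
              using False by blast
            have "b \<in> Field r" "b' \<in> Field r"
              using b(1) b'(1) CX F by (auto simp: P_def)
            then have "b' \<in> underS r b"
              using W.TOTALS b(2) W.REFL unfolding underS_def refl_on_def by blast
            then have "g \<in> Q b"
              using b'(1,2) unfolding Q_def P_def by blast
            then show ?thesis
              using b(1) by blast
          qed
          then show "y \<in> (\<Union>b\<in>P. L b)"
            using g(2) by (auto simp: P_def)
        qed
        moreover have "(\<Union>b\<in>P. L b) \<subseteq> L a"
          using Lmono[OF a] unfolding P_def underS_def by blast
        ultimately have "(\<Union>b\<in>P. L b) = L a"
          by blast
        then show ?thesis
          using Lcls[OF a] by simp
      qed
    qed
    moreover have "(\<Union>b\<in>P. V (L b)) = V (\<Union>b\<in>P. L b)"
      by (auto simp: V_def)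
    ultimately show "openin Y (topspace Y - (\<Union>b\<in>underS (Restr r C) a. V (L b)))"
      unfolding P by (simp add: V_closed_def)
  qed
  then show ?thesis
  proof (rule good_subset)
    show "openin Y (V X)"
      by (rule openin_V[OF X(1)])
    have "\<exists>a\<in>C. g \<in> L a" if g: "g \<in> X" for g
    proof -
      \<comment> \<open>Two steps up in \<open>C\<close>: below an element \<open>b\<close> of
        \<open>C\<close>, which must itself precede \<open>a\<close>.\<close>
      obtain b where b: "b \<in> C" "g \<in> underS r b"
        using cof[OF g] by blast
      obtain a where a: "a \<in> C" "b \<in> underS r a"
        using cof b(1) CX by blast
      have "g \<in> Q a"
        using a b unfolding Q_def underS_def by blast
      then have "g \<in> J 0 a"
        by (simp add: J0)
      then show ?thesis
        using a(1) unfolding L_def by blast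
    qed
    then show "V X \<subseteq> (\<Union>a\<in>Field (Restr r C). V (L a))"
      unfolding Fr V_def by blast
  qed
qed

lemma good_V: "X \<subseteq> topspace Y \<Longrightarrow> good (V X)"
proof (induction X rule: wf_induct_rule[OF wf_inv_image[OF wf_ordLess, of card_of]])
  case (1 X)
  have IH: "good (V Z)" if "Z \<subseteq> topspace Y" "|Z| <o |X|" for Z
    using 1(1)[of Z] that by (simp add: inv_image_def)
  show ?case
    using good_V_countable good_V_regular good_V_singular 1(2) IH by blast
qed

theorem good_topspace: "good (topspace Y)"
proof -
  have "V (topspace Y) = topspace Y"
    using mem_H openin_subset[OF openin_H] by (auto simp: V_def)
  then show ?thesis
    using good_V[of "topspace Y"] by simp
qed

end

section \<open>Nabla products of metrizable spaces\<close>

lemma monotonically_normal_spaceE: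
  assumes "monotonically_normal_space Y"
  obtains G where
    "\<And>x U. openin Y U \<Longrightarrow> x \<in> U \<Longrightarrow> openin Y (G x U) \<and> x \<in> G x U \<and> G x U \<subseteq> U"
    "\<And>x U y V. \<lbrakk>openin Y U; x \<in> U; openin Y V; y \<in> V; G x U \<inter> G y V \<noteq> {}\<rbrakk> \<Longrightarrow> x \<in> V \<or> y \<in> U"
proof -
  obtain G where "\<forall>x U. openin Y U \<and> x \<in> U \<longrightarrow> openin Y (G x U) \<and> x \<in> G x U \<and> G x U \<subseteq> U"
    "\<forall>x U y V. openin Y U \<and> x \<in> U \<and> openin Y V \<and> y \<in> V \<and> G x U \<inter> G y V \<noteq> {}
      \<longrightarrow> x \<in> V \<or> y \<in> U"
    using assms unfolding monotonically_normal_space_def by (elim exE conjE) (rule that)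
  then show thesis
    by (intro that[of G]) simp_all
qed

lemma (in nabla_space) paracompact_space_if_monotonically_normal:
  assumes "monotonically_normal_space Y"
  shows "paracompact_space Y"
  unfolding paracompact_space_def
proof (intro allI impI, elim conjE)
  fix \<U> assume U: "\<forall>U\<in>\<U>. openin Y U" "\<Union>\<U> = topspace Y"
  obtain G where G: "\<And>x U. openin Y U \<Longrightarrow> x \<in> U \<Longrightarrow> openin Y (G x U) \<and> x \<in> G x U \<and> G x U \<subseteq> U"
    "\<And>x U y V. \<lbrakk>openin Y U; x \<in> U; openin Y V; y \<in> V; G x U \<inter> G y V \<noteq> {}\<rbrakk> \<Longrightarrow> x \<in> V \<or> y \<in> U"
    using monotonically_normal_spaceE[OF assms] by metis
  have "\<forall>x\<in>topspace Y. \<exists>U. U \<in> \<U> \<and> x \<in> U"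
    using U(2) by blast
  from bchoice[OF this] obtain N where NU: "\<And>x. x \<in> topspace Y \<Longrightarrow> N x \<in> \<U> \<and> x \<in> N x"
    by blast
  interpret mn_nabla_space Y D G N
  proof unfold_locales
    show "openin Y (G x W) \<and> x \<in> G x W \<and> G x W \<subseteq> W" if "openin Y W" "x \<in> W" for x W
      by (rule G(1)[OF that])
    show "x \<in> W' \<or> y \<in> W"
      if "openin Y W" "x \<in> W" "openin Y W'" "y \<in> W'" "G x W \<inter> G y W' \<noteq> {}" for x W y W'
      by (rule G(2)[OF that])
    show "openin Y (N x) \<and> x \<in> N x" if "x \<in> topspace Y" for x
      using NU[OF that] U(1) by simp
  qed
  obtain \<P> where P: "\<forall>B\<in>\<P>. openin Y B \<and> (\<exists>y\<in>topspace Y. B \<subseteq> N y)" "disjoint \<P>"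
    "\<Union>\<P> = topspace Y"
    using good_topspace unfolding good_def by (elim exE conjE) (rule that)
  have "locally_finite_in Y \<P>"
    unfolding locally_finite_in_def
  proof (intro conjI ballI)
    fix x assume "x \<in> topspace Y"
    then obtain B where B: "B \<in> \<P>" "x \<in> B"
      using P(3) by blast
    have "{C \<in> \<P>. C \<inter> B \<noteq> {}} \<subseteq> {B}"
      using P(2) B(1) unfolding disjoint_def by blast
    then have "finite {C \<in> \<P>. C \<inter> B \<noteq> {}}"
      using finite_subset by blast
    then show "\<exists>V. openin Y V \<and> x \<in> V \<and> finite {C \<in> \<P>. C \<inter> V \<noteq> {}}"
      using B P(1) by blast
  qed (use P(3) in simp)
  moreover have "\<exists>U\<in>\<U>. B \<subseteq> U" if B: "B \<in> \<P>" for B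
    using P(1)[rule_format, OF B] NU by blast
  moreover have "\<forall>B\<in>\<P>. openin Y B"
    using P(1) by simp
  ultimately show "\<exists>\<V>. (\<forall>V\<in>\<V>. openin Y V) \<and> \<Union>\<V> = topspace Y \<and>
      (\<forall>V\<in>\<V>. \<exists>U\<in>\<U>. V \<subseteq> U) \<and> locally_finite_in Y \<V>"
    using P(3) by (intro exI[of _ \<P>]) simp
qed

lemma (in nabla_space) nabla_space_subtopology:
  assumes A: "A \<subseteq> topspace Y"
  shows "nabla_space (subtopology Y A) D"
proof
  have top: "topspace (subtopology Y A) = A"
    using A by auto
  show "D a a n = 0" if "a \<in> topspace (subtopology Y A)" for a n
    using D_self that by simp
  show "D a c n \<le> D a b n + D b c n"
    if "a \<in> topspace (subtopology Y A)" "b \<in> topspace (subtopology Y A)"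
      "c \<in> topspace (subtopology Y A)" for a b c n
    using D_triangle that by simp
  show "\<exists>\<^sub>F n in sequentially. 0 < D a b n"
    if "a \<in> topspace (subtopology Y A)" "b \<in> topspace (subtopology Y A)" "a \<noteq> b" for a b
    using D_sep that by simp
  fix U
  have nbA: "{b \<in> topspace (subtopology Y A). \<forall>\<^sub>F n in sequentially. D a b n < g n} = nbhd a g \<inter> A" for a g
    using A by (auto simp: nbhd_def)
  show "openin (subtopology Y A) U \<longleftrightarrow> U \<subseteq> topspace (subtopology Y A) \<and>
      (\<forall>a\<in>U. \<exists>g. (\<forall>n. 0 < g n) \<and>
        {b \<in> topspace (subtopology Y A). \<forall>\<^sub>F n in sequentially. D a b n < g n} \<subseteq> U)"
    unfolding nbA unfolding top
  proof (intro iffI conjI ballI; (elim conjE)?)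
    assume "openin (subtopology Y A) U"
    then obtain W where W: "openin Y W" "U = W \<inter> A"
      by (auto simp: openin_subtopology)
    then show "U \<subseteq> A"
      by blast
    fix a assume "a \<in> U"
    then obtain g where "\<forall>n. 0 < g n" "nbhd a g \<subseteq> W"
      using nbhd_in_open[OF W(1)] W(2) by blast
    then show "\<exists>g. (\<forall>n. 0 < g n) \<and> nbhd a g \<inter> A \<subseteq> U"
      using W(2) by blast
  next
    assume UA: "U \<subseteq> A" and "\<forall>a\<in>U. \<exists>g. (\<forall>n. 0 < g n) \<and> nbhd a g \<inter> A \<subseteq> U"
    from bchoice[OF this(2)]
    obtain g where g: "\<forall>a\<in>U. (\<forall>n. 0 < g a n) \<and> nbhd a (g a) \<inter> A \<subseteq> U" ..
    have "openin Y (\<Union>a\<in>U. nbhd a (g a))"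
      using UA A by (intro openin_Union) (auto simp: openin_nbhd)
    moreover have "U = (\<Union>a\<in>U. nbhd a (g a)) \<inter> A"
    proof
      show "U \<subseteq> (\<Union>a\<in>U. nbhd a (g a)) \<inter> A"
      proof
        fix a assume a: "a \<in> U"
        then have "a \<in> nbhd a (g a)"
          using g UA A by (intro mem_nbhd) auto
        then show "a \<in> (\<Union>a\<in>U. nbhd a (g a)) \<inter> A"
          using a UA by blast
      qed
      show "(\<Union>a\<in>U. nbhd a (g a)) \<inter> A \<subseteq> U"
        using g by blast
    qed
    ultimately show "openin (subtopology Y A) U"
      unfolding openin_subtopology by blast
  qed
qed (simp_all add: D_nonneg D_commute)

section \<open>Coordinatewise distances on the nabla product\<close>

lemma mod_finite_iff_eventually:
  "(x, y) \<in> mod_finite X \<longleftrightarrow> x \<in> topspace (box_topology X) \<and> y \<in> topspace (box_topology X) \<and>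
     (\<forall>\<^sub>F n in sequentially. x n = y n)"
  by (simp add: mod_finite_def flip: cofinite_eq_sequentially add: eventually_cofinite)

text \<open>Metrize the factors and fix a representative \<open>\<rho> a\<close> of each class.
  Another choice would change \<open>D\<close> at finitely many coordinates only, and an eventual
  bound is a box of balls up to finite changes.\<close>

lemma nabla_space_nabla_topology:
  assumes "\<And>n. metrizable_space (X n)"
  shows "\<exists>D. nabla_space (nabla_topology X) D"
proof -
  let ?B = "topspace (box_topology X)" and ?q = "\<lambda>x. mod_finite X `` {x}"
  let ?T = "topspace (nabla_topology X)"
  have "\<forall>n. \<exists>d. Metric_space (topspace (X n)) d \<and> X n = Metric_space.mtopology (topspace (X n)) d"
    using assms unfolding metrizable_space_def by (metis Metric_space.topspace_mtopology)
  from choice[OF this] obtain d where d: "\<And>n. Metric_space (topspace (X n)) (d n)"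
    "\<And>n. X n = Metric_space.mtopology (topspace (X n)) (d n)"
    by blast
  have T: "?T = ?B // mod_finite X"
    by (simp add: nabla_topology_def topspace_quotient_topology)
  define \<rho> where "\<rho> a = (SOME x. x \<in> ?B \<and> a = ?q x)" for a
  have \<rho>: "\<rho> a \<in> ?B" "?q (\<rho> a) = a" if "a \<in> ?T" for a
  proof -
    have "\<exists>x. x \<in> ?B \<and> a = ?q x"
      using that unfolding T by (auto elim: quotientE)
    from someI_ex[OF this] show "\<rho> a \<in> ?B" "?q (\<rho> a) = a"
      unfolding \<rho>_def by auto
  qed
  have \<rho>X: "\<rho> a n \<in> topspace (X n)" if "a \<in> ?T" for a n
    using \<rho>(1)[OF that] by (auto simp: topspace_box_topology)
  have q: "?q x \<in> ?T" if "x \<in> ?B" for x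
    using that unfolding T by (rule quotientI)
  have q_eq: "?q x = ?q y \<longleftrightarrow> (\<forall>\<^sub>F n in sequentially. x n = y n)" if "x \<in> ?B" "y \<in> ?B" for x y
    using eq_equiv_class_iff[OF equiv_mod_finite that] that by (simp add: mod_finite_iff_eventually)
  define D where "D a b n = d n (\<rho> a n) (\<rho> b n)" for a b n
  have "nabla_space (nabla_topology X) D"
  proof
    show "0 \<le> D a b n" for a b n
      unfolding D_def by (rule Metric_space.nonneg[OF d(1)])
    show "D a b n = D b a n" for a b n
      unfolding D_def by (rule Metric_space.commute[OF d(1)])
    show "D a a n = 0" if "a \<in> ?T" for a n
      unfolding D_def using Metric_space.zero[OF d(1) \<rho>X[OF that] \<rho>X[OF that]] by simp
    show "D a c n \<le> D a b n + D b c n" if "a \<in> ?T" "b \<in> ?T" "c \<in> ?T" for a b c n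
      unfolding D_def by (intro Metric_space.triangle[OF d(1)] \<rho>X that)
    show "\<exists>\<^sub>F n in sequentially. 0 < D a b n" if ab: "a \<in> ?T" "b \<in> ?T" "a \<noteq> b" for a b
    proof (rule ccontr)
      assume "\<not> ?thesis"
      then have "\<forall>\<^sub>F n in sequentially. \<not> 0 < D a b n"
        by (simp add: not_frequently)
      then have "\<forall>\<^sub>F n in sequentially. \<rho> a n = \<rho> b n"
      proof eventually_elim
        case (elim n)
        then have "d n (\<rho> a n) (\<rho> b n) = 0"
          using Metric_space.nonneg[OF d(1), of n "\<rho> a n" "\<rho> b n"] by (simp add: D_def)
        then show ?case
          using Metric_space.zero[OF d(1) \<rho>X[OF ab(1)] \<rho>X[OF ab(2)]] by simp
      qed
      then show False
        using q_eq[OF \<rho>(1) \<rho>(1)] \<rho>(2) ab by auto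
    qed
    fix W
    show "openin (nabla_topology X) W \<longleftrightarrow> W \<subseteq> ?T \<and>
        (\<forall>a\<in>W. \<exists>g. (\<forall>n. 0 < g n) \<and> {b \<in> ?T. \<forall>\<^sub>F n in sequentially. D a b n < g n} \<subseteq> W)"
    proof (intro iffI conjI ballI; (elim conjE)?)
      assume W: "openin (nabla_topology X) W"
      then show "W \<subseteq> ?T"
        by (rule openin_subset)
      fix a assume a: "a \<in> W"
      then have aT: "a \<in> ?T"
        using \<open>W \<subseteq> ?T\<close> by blast
      have "openin (box_topology X) {x \<in> ?B. ?q x \<in> W}"
        using W by (simp add: nabla_topology_def openin_quotient_topology)
      moreover have "\<rho> a \<in> {x \<in> ?B. ?q x \<in> W}"
        using \<rho>[OF aT] a by simp
      ultimately obtain U where U: "\<And>n. openin (X n) (U n)" "\<rho> a \<in> Pi UNIV U"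
        "Pi UNIV U \<subseteq> {x \<in> ?B. ?q x \<in> W}"
        unfolding openin_box_topology_iff by blast
      have "\<exists>e>0. Metric_space.mball (topspace (X n)) (d n) (\<rho> a n) e \<subseteq> U n" for n
      proof -
        have "openin (Metric_space.mtopology (topspace (X n)) (d n)) (U n)"
          unfolding d(2)[symmetric] by (rule U(1))
        then show ?thesis
          using U(2) unfolding Metric_space.openin_mtopology[OF d(1)] by auto
      qed
      then obtain g where g: "\<And>n. 0 < g n"
        "\<And>n. Metric_space.mball (topspace (X n)) (d n) (\<rho> a n) (g n) \<subseteq> U n"
        by metis
      have "b \<in> W" if b: "b \<in> ?T" "\<forall>\<^sub>F n in sequentially. D a b n < g n" for b
      proof -
        \<comment> \<open>Replacing \<open>\<rho> b\<close> by \<open>\<rho> a\<close> at the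
          finitely many far coordinates moves it into the box within its class.\<close>
        define y where "y n = (if D a b n < g n then \<rho> b n else \<rho> a n)" for n
        have "y n \<in> U n" for n
          using g(2)[of n] U(2) \<rho>X[OF aT, of n] \<rho>X[OF b(1), of n]
          by (auto simp: y_def D_def Metric_space.in_mball[OF d(1)])
        then have y: "y \<in> ?B" "?q y \<in> W"
          using U(3) by blast+
        have "\<forall>\<^sub>F n in sequentially. y n = \<rho> b n"
          using b(2) by eventually_elim (simp add: y_def)
        then show ?thesis
          using q_eq[OF y(1) \<rho>(1)[OF b(1)]] y(2) \<rho>(2)[OF b(1)] by simp
      qed
      then show "\<exists>g. (\<forall>n. 0 < g n) \<and> {b \<in> ?T. \<forall>\<^sub>F n in sequentially. D a b n < g n} \<subseteq> W"
        using g(1) by blast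
    next
      assume WT: "W \<subseteq> ?T"
        and W: "\<forall>a\<in>W. \<exists>g. (\<forall>n. 0 < g n) \<and> {b \<in> ?T. \<forall>\<^sub>F n in sequentially. D a b n < g n} \<subseteq> W"
      have "openin (box_topology X) {x \<in> ?B. ?q x \<in> W}"
        unfolding openin_box_topology_iff
      proof
        fix x assume x: "x \<in> {x \<in> ?B. ?q x \<in> W}"
        then have xB: "x \<in> ?B" and qx: "?q x \<in> ?T"
          using q by auto
        obtain g where g: "\<And>n. 0 < g n"
          "{b \<in> ?T. \<forall>\<^sub>F n in sequentially. D (?q x) b n < g n} \<subseteq> W"
          using W x by blast
        define U where "U n = Metric_space.mball (topspace (X n)) (d n) (x n) (g n)" for n
        have "openin (X n) (U n)" for n
          using Metric_space.openin_mball[OF d(1), of n "x n" "g n"]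
          unfolding U_def d(2)[symmetric] .
        moreover have "x \<in> Pi UNIV U"
          using xB g(1) by (auto simp: U_def topspace_box_topology Metric_space.centre_in_mball_iff[OF d(1)])
        moreover have "?q y \<in> W \<and> y \<in> ?B" if y: "y \<in> Pi UNIV U" for y
        proof -
          have yU: "y n \<in> topspace (X n)" "d n (x n) (y n) < g n" for n
            using y by (auto simp: U_def Pi_iff Metric_space.in_mball[OF d(1)])
          then have yB: "y \<in> ?B"
            by (auto simp: topspace_box_topology)
          \<comment> \<open>The chosen representative of the class of \<open>x\<close> may differ
            from \<open>x\<close>, but only at finitely many coordinates.\<close>
          have "\<forall>\<^sub>F n in sequentially. \<rho> (?q x) n = x n" "\<forall>\<^sub>F n in sequentially. \<rho> (?q y) n = y n"
            using q_eq[OF \<rho>(1)[OF q[OF xB]] xB] q_eq[OF \<rho>(1)[OF q[OF yB]] yB] \<rho>(2) q xB yB by auto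
          then have "\<forall>\<^sub>F n in sequentially. D (?q x) (?q y) n < g n"
            by eventually_elim (simp add: D_def yU)
          then show ?thesis
            using g(2) q[OF yB] yB by blast
        qed
        ultimately show "\<exists>U. (\<forall>n. openin (X n) (U n)) \<and> x \<in> Pi UNIV U \<and>
            Pi UNIV U \<subseteq> {x \<in> ?B. ?q x \<in> W}"
          by blast
      qed
      then show "openin (nabla_topology X) W"
        using WT T by (simp add: nabla_topology_def openin_quotient_topology)
    qed
  qed
  then show ?thesis
    by (rule exI[of _ D])
qed

text \<open>Apply \<open>G\<close> to one chosen open extension \<open>E U\<close> of each
  relatively open \<open>U\<close>. The points concerned lie in \<open>S\<close>, where membership
  in an extension is membership in the original set.\<close>

lemma monotonically_normal_space_subtopology:
  assumes "monotonically_normal_space Y"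
  shows "monotonically_normal_space (subtopology Y S)"
proof -
  obtain G where G: "\<And>x U. openin Y U \<Longrightarrow> x \<in> U \<Longrightarrow> openin Y (G x U) \<and> x \<in> G x U \<and> G x U \<subseteq> U"
    "\<And>x U y V. \<lbrakk>openin Y U; x \<in> U; openin Y V; y \<in> V; G x U \<inter> G y V \<noteq> {}\<rbrakk> \<Longrightarrow> x \<in> V \<or> y \<in> U"
    using monotonically_normal_spaceE[OF assms] by metis
  define E where "E U = (SOME W. openin Y W \<and> U = W \<inter> S)" for U
  have E: "openin Y (E U)" "U = E U \<inter> S" if "openin (subtopology Y S) U" for U
  proof -
    have "\<exists>W. openin Y W \<and> U = W \<inter> S"
      using that by (simp add: openin_subtopology)
    from someI_ex[OF this] show "openin Y (E U)" "U = E U \<inter> S"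
      unfolding E_def by auto
  qed
  show ?thesis
    unfolding monotonically_normal_space_def
  proof (intro exI[of _ "\<lambda>x U. G x (E U) \<inter> S"] conjI allI impI; elim conjE)
    fix x U assume U: "openin (subtopology Y S) U" "x \<in> U"
    then have "x \<in> E U" "x \<in> S"
      using E(2)[OF U(1)] by auto
    note * = G(1)[OF E(1)[OF U(1)] this(1)]
    show "openin (subtopology Y S) (G x (E U) \<inter> S)"
      using * by (auto simp: openin_subtopology)
    show "x \<in> G x (E U) \<inter> S"
      using * \<open>x \<in> S\<close> by blast
    show "G x (E U) \<inter> S \<subseteq> U"
      using * E(2)[OF U(1)] by blast
  next
    fix x U y V
    assume U: "openin (subtopology Y S) U" "x \<in> U" and V: "openin (subtopology Y S) V" "y \<in> V"
      and ne: "G x (E U) \<inter> S \<inter> (G y (E V) \<inter> S) \<noteq> {}"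
    have mem: "x \<in> E U" "x \<in> S" "y \<in> E V" "y \<in> S"
      using E(2)[OF U(1)] E(2)[OF V(1)] U(2) V(2) by auto
    have "x \<in> E V \<or> y \<in> E U"
      using ne by (intro G(2)[OF E(1)[OF U(1)] mem(1) E(1)[OF V(1)] mem(3)]) blast
    then show "x \<in> V \<or> y \<in> U"
      using E(2)[OF U(1)] E(2)[OF V(1)] mem by blast
  qed
qed

theorem theorem8:
  fixes X :: "nat \<Rightarrow> 'a topology" and A :: "(nat \<Rightarrow> 'a) set set"
  assumes "\<And>n. metrizable_space (X n)"
    and "A \<subseteq> topspace (nabla_topology X)"
    and "monotonically_normal_space (subtopology (nabla_topology X) A)"
  shows "hereditarily_paracompact_space (subtopology (nabla_topology X) A)"
  unfolding hereditarily_paracompact_space_def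
proof (intro allI impI)
  fix S assume "S \<subseteq> topspace (subtopology (nabla_topology X) A)"
  obtain D where "nabla_space (nabla_topology X) D"
    using nabla_space_nabla_topology[OF assms(1)] ..
  then have "nabla_space (subtopology (nabla_topology X) A) D"
    by (rule nabla_space.nabla_space_subtopology[OF _ assms(2)])
  then have "nabla_space (subtopology (subtopology (nabla_topology X) A) S) D"
    by (rule nabla_space.nabla_space_subtopology) fact
  then show "paracompact_space (subtopology (subtopology (nabla_topology X) A) S)"
    by (rule nabla_space.paracompact_space_if_monotonically_normal)
      (rule monotonically_normal_space_subtopology[OF assms(3)])
qed

end
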